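(* (Single Label Clique Theorem) Let $m=n^{\alpha}$ with a constant $0<\alpha<1$, and let $p=p(n)$ satisfy $mp^2=O(1)$. Then with high probability, in a random instance of $\mathcal G_{n,m,p}$, every clique $Q$ with $|Q|\sim np$ is formed by a single label. In particular, the maximum clique is formed by a single label.
   Context: Random intersection graph $\mathcal G_{n,m,p}$: a set $V$ of $n$ vertices and labels $\mathcal M=\{1,\dots,m\}$; each vertex $v$ independently receives $S_v\subseteq\mathcal M$ containing each label independently with probability $p$; distinct $u,v$ are adjacent iff $S_u\cap S_v\neq\emptyset$. For $i\in\mathcal M$, $L_i=\{v: i\in S_v\}$. A clique $Q$ is formed by a single label if $Q\subseteq L_i$ for some label $i$. $f\sim g$ means $f/g\to1$; "with high probability" means with probability tending to $1$ as $n\to\infty$.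
   Formalization: Cliques are required to have at least two vertices: otherwise the claim fails (e.g. p = 1/n, where a vertex with no label is a clique of size np lying in no L_i; or p = 0 for the maximum clique). Also, m is n^α rounded to an integer. *)

theory Defs
  imports "HOL-Probability.Probability" "HOL-Library.Landau_Symbols"
begin

text \<open>An instance is represented by its label assignment: \<open>S v\<close> is the label set of vertex \<open>v\<close>,
  with vertices \<open>{1..n}\<close> and labels \<open>{1..m}\<close>. Outside \<open>{1..n}\<close>, \<open>S\<close> is almost surely empty.\<close>

definition label_set_pmf :: "nat \<Rightarrow> real \<Rightarrow> nat set pmf" where
  "label_set_pmf m p =
     map_pmf (\<lambda>b. {i \<in> {1..m}. b i}) (Pi_pmf {1..m} False (\<lambda>_. bernoulli_pmf p))"

definition rig_pmf :: "nat \<Rightarrow> nat \<Rightarrow> real \<Rightarrow> (nat \<Rightarrow> nat set) pmf" where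
  "rig_pmf n m p = Pi_pmf {1..n} {} (\<lambda>_. label_set_pmf m p)"

definition adjacent :: "(nat \<Rightarrow> nat set) \<Rightarrow> nat \<Rightarrow> nat \<Rightarrow> bool" where
  "adjacent S u v \<longleftrightarrow> u \<noteq> v \<and> S u \<inter> S v \<noteq> {}"

definition label_class :: "nat \<Rightarrow> (nat \<Rightarrow> nat set) \<Rightarrow> nat \<Rightarrow> nat set" where
  "label_class n S i = {v \<in> {1..n}. i \<in> S v}"

definition clique :: "nat \<Rightarrow> (nat \<Rightarrow> nat set) \<Rightarrow> nat set \<Rightarrow> bool" where
  "clique n S Q \<longleftrightarrow> Q \<subseteq> {1..n} \<and> (\<forall>u\<in>Q. \<forall>v\<in>Q. u \<noteq> v \<longrightarrow> adjacent S u v)"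

definition maximum_clique :: "nat \<Rightarrow> (nat \<Rightarrow> nat set) \<Rightarrow> nat set \<Rightarrow> bool" where
  "maximum_clique n S Q \<longleftrightarrow> clique n S Q \<and> (\<forall>Q'. clique n S Q' \<longrightarrow> card Q' \<le> card Q)"

definition single_label :: "nat \<Rightarrow> nat \<Rightarrow> (nat \<Rightarrow> nat set) \<Rightarrow> nat set \<Rightarrow> bool" where
  "single_label n m S Q \<longleftrightarrow> (\<exists>i\<in>{1..m}. Q \<subseteq> label_class n S i)"

definition whp :: "(nat \<Rightarrow> 'a pmf) \<Rightarrow> (nat \<Rightarrow> 'a \<Rightarrow> bool) \<Rightarrow> bool" where
  "whp D A \<longleftrightarrow> (\<lambda>n. measure_pmf.prob (D n) {x. A n x}) \<longlonglongrightarrow> 1"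

end

theory Submission
  imports Defs "HOL-Real_Asymp.Real_Asymp"
begin

text \<open>
  Let \<open>\<delta> = (1 - \<alpha>) / 4\<close>. If \<open>n p < n powr \<delta>\<close> then \<open>n m p\<^sup>2\<close> tends to \<open>0\<close>, and a first moment argument
  excludes two vertices sharing two labels as well as triangles whose edges come from three distinct
  labels; without these configurations every clique is formed by a single label.

  If \<open>n p \<ge> n powr \<delta>\<close>, consider a clique \<open>Q\<close> with \<open>k \<ge> (1 - \<eta>) n p\<close> vertices and call a label heavy if it
  occurs on more than \<open>c k / ln n\<close> of them. Label classes have small pairwise intersections, so there are
  \<open>O(ln n)\<close> heavy labels and few vertices of \<open>Q\<close> carry two of them. If no label covered nearly all of
  \<open>Q\<close>, one could split the remaining vertices along heavy labels into two sides \<open>T\<close>, \<open>W\<close> of linear size with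
  all pairs in \<open>T \<times> W\<close> joined by light labels only. For given label sets on \<open>T\<close>, a single vertex meets all
  of them through light labels with probability at most \<open>n powr (- K)\<close>, where \<open>K\<close> is as large as we please;
  this beats the number of choices of \<open>(T, W)\<close>. Hence some label \<open>i\<close> covers nearly all of \<open>Q\<close>, and then
  all of \<open>Q\<close>, because a vertex outside \<open>L_i\<close> is adjacent to at most a fraction bounded away from \<open>1\<close> of \<open>L_i\<close>.
\<close>

section \<open>Product distributions\<close>

text \<open>Fubini: the coordinates in \<open>A\<close> are drawn first, and \<open>g s\<close>
  bounds the conditional probability given their values \<open>s\<close>. Letting the bound depend
  on \<open>s\<close> allows an exponential weight in the number of labels found so far to be
  averaged later.\<close>

lemma prob_Pi_pmf_union_le:
  fixes g :: "('a \<Rightarrow> 'b) \<Rightarrow> real"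
  assumes "finite A" "finite B" "A \<inter> B = {}"
    and int: "integrable (Pi_pmf A d D) g"
    and le: "\<And>s. measure_pmf.prob (Pi_pmf B d D) {t. P (\<lambda>x. if x \<in> A then s x else t x)} \<le> g s"
  shows "measure_pmf.prob (Pi_pmf (A \<union> B) d D) {S. P S} \<le> measure_pmf.expectation (Pi_pmf A d D) g"
proof -
  let ?M = "Pi_pmf A d D" and ?N = "Pi_pmf B d D"
  let ?X = "\<lambda>s. {t. P (\<lambda>x. if x \<in> A then s x else t x)}"
  have g0: "0 \<le> g s" for s
    using le[of s] measure_nonneg[of "measure_pmf ?N" "?X s"] by linarith
  have "emeasure (Pi_pmf (A \<union> B) d D) {S. P S}
      = emeasure (pair_pmf ?M ?N) {(s, t). P (\<lambda>x. if x \<in> A then s x else t x)}"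
    by (subst Pi_pmf_union[OF assms(1-3)]) (auto simp: vimage_def case_prod_beta')
  also have "\<dots> = (\<integral>\<^sup>+z. indicator {(s, t). P (\<lambda>x. if x \<in> A then s x else t x)} z \<partial>pair_pmf ?M ?N)"
    by simp
  also have "\<dots> = (\<integral>\<^sup>+s. (\<integral>\<^sup>+t. indicator {(s, t). P (\<lambda>x. if x \<in> A then s x else t x)} (s, t) \<partial>?N) \<partial>?M)"
    by (rule nn_integral_pair_pmf')
  also have "\<dots> = (\<integral>\<^sup>+s. emeasure ?N (?X s) \<partial>?M)"
  proof (intro nn_integral_cong)
    fix s
    have "(\<integral>\<^sup>+t. indicator {(s, t). P (\<lambda>x. if x \<in> A then s x else t x)} (s, t) \<partial>?N)
        = (\<integral>\<^sup>+t. indicator (?X s) t \<partial>?N)"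
      by (intro nn_integral_cong) (simp add: indicator_def)
    then show "(\<integral>\<^sup>+t. indicator {(s, t). P (\<lambda>x. if x \<in> A then s x else t x)} (s, t) \<partial>?N)
        = emeasure ?N (?X s)"
      by simp
  qed
  also have "\<dots> \<le> (\<integral>\<^sup>+s. ennreal (g s) \<partial>?M)"
    by (intro nn_integral_mono) (simp add: measure_pmf.emeasure_eq_measure le g0)
  also have "\<dots> = ennreal (measure_pmf.expectation ?M g)"
    by (rule nn_integral_eq_integral[OF int]) (simp add: g0)
  finally show ?thesis
    by (simp add: measure_pmf.emeasure_eq_measure g0)
qed

text \<open>The uniform case, used to treat the label sets of some vertices as deterministic while
  the others stay random.\<close>

lemma prob_Pi_pmf_cond_le:
  assumes "finite V" "A \<subseteq> V"
    and le: "\<And>s. measure_pmf.prob (Pi_pmf (V - A) d D) {t. P (\<lambda>x. if x \<in> A then s x else t x)} \<le> c"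
  shows "measure_pmf.prob (Pi_pmf V d D) {S. P S} \<le> c"
proof -
  have V: "A \<union> (V - A) = V" using assms by auto
  have "finite A" using assms finite_subset by blast
  then have "measure_pmf.prob (Pi_pmf (A \<union> (V - A)) d D) {S. P S}
      \<le> measure_pmf.expectation (Pi_pmf A d D) (\<lambda>_. c)"
    using assms by (intro prob_Pi_pmf_union_le) auto
  then show ?thesis unfolding V by simp
qed

section \<open>Exponential moments and Chernoff bounds\<close>

lemma expectation_power_card_Pi_pmf:
  fixes z :: real
  assumes "finite V" "0 \<le> z" and q: "measure_pmf.prob D {x. P x} = q"
  shows "integrable (Pi_pmf V d (\<lambda>_. D)) (\<lambda>S. z ^ card {v\<in>V. P (S v)})"
    and "measure_pmf.expectation (Pi_pmf V d (\<lambda>_. D)) (\<lambda>S. z ^ card {v\<in>V. P (S v)})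
           = (1 + q * (z - 1)) ^ card V"
proof -
  define f where "f x = (if P x then z else 1)" for x
  have f: "f x = 1 + (z - 1) * indicator {x. P x} x" for x by (simp add: f_def)
  have int: "integrable D f" unfolding f
    by (intro Bochner_Integration.integrable_add integrable_mult_right) (auto intro!: integrable_real_indicator simp: less_top[symmetric])
  have E: "measure_pmf.expectation D f = 1 + q * (z - 1)"
    unfolding f by (subst Bochner_Integration.integral_add)
      (auto intro!: integrable_mult_right integrable_real_indicator simp: q less_top[symmetric])
  have card: "z ^ card {v\<in>V. P (S v)} = (\<Prod>v\<in>V. f (S v))" for S
    using assms(1) unfolding f_def by (simp add: prod.If_cases Int_def)
  show "integrable (Pi_pmf V d (\<lambda>_. D)) (\<lambda>S. z ^ card {v\<in>V. P (S v)})"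
    unfolding card by (intro integrable_prod_Pi_pmf assms int)
  show "measure_pmf.expectation (Pi_pmf V d (\<lambda>_. D)) (\<lambda>S. z ^ card {v\<in>V. P (S v)})
           = (1 + q * (z - 1)) ^ card V"
    unfolding card using assms(2)
    by (subst expectation_prod_Pi_pmf) (auto simp: assms int E f_def)
qed

text \<open>Markov's inequality for \<open>z ^ card\<close>, followed by 1 + x \<le> exp x. The
  event enters only through \<open>X\<close>, so that one proof serves both tails: the upper one
  with z \<ge> 1, the lower one with z \<le> 1.\<close>

lemma exp_moment_card_le:
  fixes z :: real
  assumes "finite V" "0 < z" and q: "measure_pmf.prob D {x. P x} = q"
    and X: "\<And>S. P' S \<Longrightarrow> z powr \<tau> \<le> z ^ card {v\<in>V. P (S v)}"
  shows "measure_pmf.prob (Pi_pmf V d (\<lambda>_. D)) {S. P' S}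
           \<le> exp ((z - 1) * real (card V) * q - \<tau> * ln z)"
proof -
  let ?M = "Pi_pmf V d (\<lambda>_. D)"
  have q01: "0 \<le> q" "q \<le> 1" using q by auto
  have "measure_pmf.prob ?M {S. P' S} \<le> measure_pmf.prob ?M {S. z powr \<tau> \<le> z ^ card {v\<in>V. P (S v)}}"
    by (intro measure_pmf.finite_measure_mono) (auto dest: X)
  also have "\<dots> \<le> (1 + q * (z - 1)) ^ card V / z powr \<tau>"
    using integral_Markov_inequality_measure[of "measure_pmf ?M" "\<lambda>S. z ^ card {v\<in>V. P (S v)}" UNIV "z powr \<tau>"]
      expectation_power_card_Pi_pmf[OF assms(1) _ q, of z d] assms(2)
    by simp
  also have "\<dots> \<le> exp (q * (z - 1)) ^ card V / z powr \<tau>"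
  proof (intro divide_right_mono power_mono)
    \<comment> \<open>Monotonicity of powers needs a nonnegative base; for z < 1 this rests on q
      \<le> 1.\<close>
    have "q * (1 - z) \<le> 1"
    proof (cases "z \<le> 1")
      case True
      then show ?thesis using mult_mono[of q 1 "1-z" 1] q01 assms(2) by simp
    next
      case False
      then show ?thesis using mult_nonneg_nonneg[of q "z - 1"] q01 by (simp add: algebra_simps)
    qed
    then show "0 \<le> 1 + q * (z - 1)" by (simp add: algebra_simps)
  qed (auto simp: exp_ge_add_one_self)
  also have "\<dots> = exp ((z - 1) * real (card V) * q - \<tau> * ln z)"
    using assms(2) by (simp add: powr_def exp_diff exp_of_nat_mult[symmetric] mult_ac)
  finally show ?thesis .
qed

lemma chernoff_upper:
  fixes z :: real
  assumes "finite V" "1 \<le> z" and q: "measure_pmf.prob D {x. P x} \<le> q"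
  shows "measure_pmf.prob (Pi_pmf V d (\<lambda>_. D)) {S. \<tau> \<le> real (card {v\<in>V. P (S v)})}
           \<le> exp ((z - 1) * real (card V) * q - \<tau> * ln z)"
proof -
  have "measure_pmf.prob (Pi_pmf V d (\<lambda>_. D)) {S. \<tau> \<le> real (card {v\<in>V. P (S v)})}
      \<le> exp ((z - 1) * real (card V) * measure_pmf.prob D {x. P x} - \<tau> * ln z)"
    using assms by (intro exp_moment_card_le) (auto simp: powr_realpow[symmetric] intro!: powr_mono)
  also have "\<dots> \<le> exp ((z - 1) * real (card V) * q - \<tau> * ln z)"
    using assms by (auto intro!: mult_left_mono)
  finally show ?thesis .
qed

lemma chernoff_lower:
  fixes z :: real
  assumes "finite V" "0 < z" "z \<le> 1" and q: "measure_pmf.prob D {x. P x} = q"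
  shows "measure_pmf.prob (Pi_pmf V d (\<lambda>_. D)) {S. real (card {v\<in>V. P (S v)}) \<le> \<tau>}
           \<le> exp ((z - 1) * real (card V) * q - \<tau> * ln z)"
  using assms by (intro exp_moment_card_le) (auto simp: powr_realpow[symmetric] intro!: powr_mono')

text \<open>This is the Chernoff exponent at the optimal \<open>z = r / q\<close>. Strictness of ln
  x < x - 1 for x \<noteq> 1 makes it negative for \<open>r\<close> on either side of
  \<open>q\<close>.\<close>

lemma chernoff_exponent_neg:
  fixes q r :: real
  assumes "0 < q" "0 < r" "q \<noteq> r"
  shows "(r / q - 1) * q - r * ln (r / q) < 0"
proof -
  have "ln (q / r) < q / r - 1"
    using assms ln_le_minus_one[of "q / r"] ln_eq_minus_one[of "q / r"]
    by (fastforce simp: less_le)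
  then have "r * ln (q / r) < r * (q / r - 1)" using assms by simp
  then have "r * ln q - r * ln r < q - r"
    using assms by (simp add: ln_div right_diff_distrib)
  then show ?thesis using assms by (simp add: ln_div algebra_simps)
qed

section \<open>Random subsets that must hit every member of a family\<close>

lemma prob_Pi_bernoulli_pattern:
  assumes "finite U" "A \<subseteq> U" "B \<subseteq> U" "A \<inter> B = {}" "0 \<le> p" "p \<le> 1"
  shows "measure_pmf.prob (Pi_pmf U False (\<lambda>_. bernoulli_pmf p)) {b. (\<forall>j\<in>A. b j) \<and> (\<forall>j\<in>B. \<not> b j)}
           = p ^ card A * (1 - p) ^ card B"
proof -
  let ?M = "Pi_pmf U False (\<lambda>_. bernoulli_pmf p)"
  let ?C = "\<lambda>j. if j \<in> A then {True} else if j \<in> B then {False} else UNIV"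
  have "{b. (\<forall>j\<in>A. b j) \<and> (\<forall>j\<in>B. \<not> b j)} = Pi U ?C"
    using assms(2-4) by (auto simp: Pi_def split: if_splits)
  then have "measure_pmf.prob ?M {b. (\<forall>j\<in>A. b j) \<and> (\<forall>j\<in>B. \<not> b j)}
      = (\<Prod>j\<in>U. measure_pmf.prob (bernoulli_pmf p) (?C j))"
    by (simp only: measure_Pi_pmf_Pi[OF assms(1)])
  also have "\<dots> = (\<Prod>j\<in>U. (if j \<in> A then p else 1) * (if j \<in> B then 1 - p else 1))"
    using assms by (intro prod.cong) (auto simp: measure_pmf_single)
  also have "\<dots> = p ^ card A * (1 - p) ^ card B"
    using assms(1-3) by (simp add: prod.distrib prod.If_cases Int_absorb1)
  finally show ?thesis .
qed

text \<open>Expose the random set on one \<open>A a\<close> at a time: each label found there takes care of at most \<open>d\<close> members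
  of the family, which costs a factor \<open>y\<close>, while finding none is fatal. The last hypothesis says that these
  two effects balance.\<close>

lemma prob_hit_family_le:
  fixes A :: "'i \<Rightarrow> 'a set" and y d p :: real
  assumes "finite U" "finite I" and p: "0 \<le> p" "p \<le> 1" and y: "1 \<le> y" and d: "0 < d"
    and sub: "\<And>a. a \<in> I \<Longrightarrow> A a \<subseteq> U"
    and card: "\<And>a. a \<in> I \<Longrightarrow> card (A a) \<le> K"
    and deg: "\<And>j. j \<in> U \<Longrightarrow> real (card {a\<in>I. j \<in> A a}) \<le> d"
    and K: "\<And>k. k \<le> K \<Longrightarrow> (1 + p * (y - 1)) ^ k - (1 - p) ^ k \<le> 1"
  shows "measure_pmf.prob (Pi_pmf U False (\<lambda>_. bernoulli_pmf p)) {b. \<forall>a\<in>I. \<exists>j\<in>A a. b j}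
           \<le> y powr (- real (card I) / d)"
  using assms(1,2) sub card deg
proof (induction "card I" arbitrary: I U A rule: less_induct)
  case less
  let ?D = "\<lambda>_. bernoulli_pmf p"
  show ?case
  proof (cases "I = {}")
    case True
    then show ?thesis using y by (simp add: measure_pmf.prob_le_1)
  next
    case False
    then obtain a0 where a0: "a0 \<in> I" by auto
    define A0 where "A0 = A a0"
    have A0U: "A0 \<subseteq> U" and fA0: "finite A0"
      using less.prems(1,3) a0 by (auto simp: A0_def intro: finite_subset)
    define B where "B = U - A0"
    have U: "U = A0 \<union> B" "A0 \<inter> B = {}" "finite B"
      using A0U less.prems(1) by (auto simp: B_def)
    let ?c = "y powr (- real (card I) / d)"
    let ?X = "\<lambda>s. {j\<in>A0. s j}"
    \<comment> \<open>If no label of \<open>A0\<close> is found, the indicator cancels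
      \<open>y ^ 0\<close> and \<open>g s\<close> is 0, because \<open>A0\<close> then stays unhit.
      Otherwise \<open>g s\<close> is the induction bound after every found label has cost one
      factor \<open>y\<close>.\<close>
    define g where "g s = ?c * (y ^ card (?X s) - indicator {s. \<forall>j\<in>A0. \<not> s j} s)" for s
    have mgf: "measure_pmf.prob (bernoulli_pmf p) {x. x} = p"
    proof -
      have "{x. x} = {True}" by auto
      then show ?thesis using p by (simp add: measure_pmf_single)
    qed
    note E = expectation_power_card_Pi_pmf[OF fA0 _ mgf, of y False]
    have int: "integrable (Pi_pmf A0 False ?D) g"
      unfolding g_def using E(1) y
      by (intro integrable_mult_right Bochner_Integration.integrable_diff integrable_real_indicator)
         (auto simp: less_top[symmetric])
    have "measure_pmf.prob (Pi_pmf (A0 \<union> B) False ?D) {b. \<forall>a\<in>I. \<exists>j\<in>A a. b j}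
        \<le> measure_pmf.expectation (Pi_pmf A0 False ?D) g"
    proof (rule prob_Pi_pmf_union_le[OF fA0 U(3,2) int])
      fix s
      show "measure_pmf.prob (Pi_pmf B False ?D) {t. \<forall>a\<in>I. \<exists>j\<in>A a. if j \<in> A0 then s j else t j} \<le> g s"
        (is "measure_pmf.prob _ ?E \<le> _")
      proof (cases "\<forall>j\<in>A0. \<not> s j")
        case True
        then have "?E = {}" using a0 by (auto simp: A0_def)
        moreover have "?X s = {}" using True by auto
        then have "g s = 0" using True by (simp only: g_def) simp
        ultimately show ?thesis by (simp only: measure_empty order.refl)
      next
        case False
        \<comment> \<open>\<open>J\<close> collects the members not yet hit. Since \<open>a0\<close>
          has been hit, \<open>J\<close> is strictly smaller than \<open>I\<close>, and the
          induction applies to the sets with \<open>A0\<close> removed.\<close>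
        define J where "J = {a\<in>I. A a \<inter> ?X s = {}}"
        define A' where "A' a = A a - A0" for a
        have J: "J \<subset> I" using False a0 by (auto simp: J_def A0_def)
        have fJ: "finite J" using less.prems(2) J finite_subset by blast
        have "measure_pmf.prob (Pi_pmf B False ?D) ?E
            \<le> measure_pmf.prob (Pi_pmf B False ?D) {t. \<forall>a\<in>J. \<exists>j\<in>A' a. t j}"
        proof (intro measure_pmf.finite_measure_mono subsetI CollectI ballI)
          fix t a assume t: "t \<in> ?E" and a: "a \<in> J"
          then obtain j where j: "j \<in> A a" "if j \<in> A0 then s j else t j" by (auto simp: J_def)
          moreover have "j \<notin> A0"
          proof
            assume "j \<in> A0"
            then have "j \<in> A a \<inter> ?X s" using j by simp
            then show False using a by (auto simp: J_def)
          qed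
          ultimately show "\<exists>j\<in>A' a. t j" by (auto simp: A'_def)
        qed simp
        also have "\<dots> \<le> y powr (- real (card J) / d)"
        proof (rule less.hyps)
          show "card J < card I" using psubset_card_mono[OF less.prems(2) J] .
          show "A' a \<subseteq> B" if "a \<in> J" for a using that less.prems(3) by (auto simp: J_def A'_def B_def)
          show "card (A' a) \<le> K" if "a \<in> J" for a
          proof -
            have "card (A' a) \<le> card (A a)" unfolding A'_def
              using less.prems(1) less.prems(3)[of a] that by (intro card_mono) (auto simp: J_def intro: finite_subset)
            then show ?thesis using less.prems(4)[of a] that by (auto simp: J_def)
          qed
          show "real (card {a\<in>J. j \<in> A' a}) \<le> d" if "j \<in> B" for j
          proof -
            have "card {a\<in>J. j \<in> A' a} \<le> card {a\<in>I. j \<in> A a}"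
              using less.prems(2) by (intro card_mono) (auto simp: J_def A'_def)
            then show ?thesis using less.prems(5)[of j] that by (auto simp: B_def)
          qed
        qed (use U fJ in auto)
        also have "\<dots> \<le> y powr (- real (card I) / d + real (card (?X s)))"
        proof (rule powr_mono[OF _ y])
          \<comment> \<open>Every found label hits at most \<open>d\<close> members, so
            \<open>card I\<close> is at most \<open>card J\<close> plus \<open>d\<close> times the
            number of labels found.\<close>
          have "I \<subseteq> J \<union> (\<Union>j\<in>?X s. {a\<in>I. j \<in> A a})" by (auto simp: J_def)
          then have "card I \<le> card (J \<union> (\<Union>j\<in>?X s. {a\<in>I. j \<in> A a}))"
            using fA0 fJ less.prems(2) by (intro card_mono) auto
          also have "\<dots> \<le> card J + (\<Sum>j\<in>?X s. card {a\<in>I. j \<in> A a})"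
            using fA0 by (intro order.trans[OF card_Un_le] add_mono card_UN_le) auto
          finally have "real (card I) \<le> real (card J + (\<Sum>j\<in>?X s. card {a\<in>I. j \<in> A a}))"
            by (simp only: of_nat_le_iff)
          also have "\<dots> = real (card J) + (\<Sum>j\<in>?X s. real (card {a\<in>I. j \<in> A a}))"
            by (simp only: of_nat_add of_nat_sum)
          also have "\<dots> \<le> real (card J) + (\<Sum>j\<in>?X s. d)"
            using A0U less.prems(5) by (intro add_mono sum_mono) auto
          finally show "- real (card J) / d \<le> - real (card I) / d + real (card (?X s))"
            using d by (simp add: field_simps)
        qed
        also have "\<dots> = g s"
        proof -
          have "indicator {s. \<forall>j\<in>A0. \<not> s j} s = (0::real)" using False by (simp add: indicator_def)
          moreover have "y powr (- real (card I) / d + real (card (?X s))) = ?c * y ^ card (?X s)"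
            using y by (subst powr_add) (simp add: powr_realpow)
          ultimately show ?thesis unfolding g_def by simp
        qed
        finally show ?thesis .
      qed
    qed
    also have "\<dots> = ?c * ((1 + p * (y - 1)) ^ card A0 - (1 - p) ^ card A0)"
    proof -
      have "integrable (Pi_pmf A0 False ?D) (indicat_real {s. \<forall>j\<in>A0. \<not> s j})"
        by (intro integrable_real_indicator) (auto simp: less_top[symmetric])
      then show ?thesis
        unfolding g_def integral_mult_right_zero
        using E y prob_Pi_bernoulli_pattern[OF fA0 empty_subsetI order.refl _ p]
        by (subst Bochner_Integration.integral_diff) simp_all
    qed
    also have "\<dots> \<le> ?c * 1"
      using K[of "card A0"] less.prems(4)[OF a0] by (intro mult_left_mono) (auto simp: A0_def)
    finally show ?thesis by (simp add: U(1)[symmetric])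
  qed
qed

section \<open>Typical label assignments\<close>

lemma one_minus_power_ge_exp:
  fixes p B :: real
  assumes "0 < p" "p \<le> 1/2" "real k \<le> B / p"
  shows "exp (- 2 * B) \<le> (1 - p) ^ k"
proof -
  have "p * p \<le> p * (1/2)" using assms by (intro mult_left_mono) auto
  then have "- 2 * p \<le> - p - 2 * p\<^sup>2" by (simp add: power2_eq_square)
  also have "\<dots> \<le> ln (1 - p)" using assms by (intro ln_one_minus_pos_lower_bound) auto
  finally have "- 2 * p \<le> ln (1 - p)" .
  then have "real k * (- 2 * p) \<le> real k * ln (1 - p)" by (intro mult_left_mono) auto
  moreover have "real k * p \<le> B" using assms by (simp add: field_simps)
  ultimately have "- 2 * B \<le> real k * ln (1 - p)" by (simp add: algebra_simps)
  then have "exp (- 2 * B) \<le> exp (real k * ln (1 - p))" by simp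
  also have "\<dots> = (1 - p) ^ k" using assms by (simp add: exp_of_nat_mult)
  finally show ?thesis .
qed

text \<open>\<open>y\<close> makes exp (B * (y - 1)) equal to 1 + exp (- 2 * B); the excess over 1
  is paid for by the chance (1 - p) ^ k \<ge> exp (- 2 * B) of finding nothing. This is the balance
  condition of \<open>prob_hit_family_le\<close>, with some \<open>y\<close> > 1 that depends on
  \<open>B\<close> only.\<close>

lemma hit_moment_le_one:
  fixes p B :: real
  assumes "0 < p" "p \<le> 1/2" "0 < B" "real k \<le> B / p"
  defines "y \<equiv> 1 + ln (1 + exp (- 2 * B)) / B"
  shows "(1 + p * (y - 1)) ^ k - (1 - p) ^ k \<le> 1"
proof -
  have y: "1 \<le> y" using assms by (simp add: y_def)
  have "(1 + p * (y - 1)) ^ k \<le> exp (p * (y - 1)) ^ k"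
    using assms y exp_ge_add_one_self[of "p * (y - 1)"] by (intro power_mono) auto
  also have "\<dots> = exp (real k * p * (y - 1))" by (simp add: exp_of_nat_mult mult.assoc)
  also have "\<dots> \<le> exp (B * (y - 1))"
    using assms(1,4) y by (intro iffD2[OF exp_le_cancel_iff] mult_right_mono) (auto simp: field_simps)
  also have "\<dots> = 1 + exp (- 2 * B)"
  proof -
    have "B * (y - 1) = ln (1 + exp (- 2 * B))" using assms(3) by (simp add: y_def)
    moreover have "0 < 1 + exp (- 2 * B)" by (simp add: add_pos_pos)
    ultimately show ?thesis by simp
  qed
  finally show ?thesis using one_minus_power_ge_exp[OF assms(1,2,4)] by linarith
qed

section \<open>Union bounds and the law of the label sets\<close>

lemma prob_Bex_le:
  assumes "finite X" "\<And>x. x \<in> X \<Longrightarrow> measure_pmf.prob M {S. P x S} \<le> c x"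
  shows "measure_pmf.prob M {S. \<exists>x\<in>X. P x S} \<le> (\<Sum>x\<in>X. c x)"
proof -
  have "{S. \<exists>x\<in>X. P x S} = (\<Union>x\<in>X. {S. P x S})" by auto
  then have "measure_pmf.prob M {S. \<exists>x\<in>X. P x S} \<le> (\<Sum>x\<in>X. measure_pmf.prob M {S. P x S})"
    using assms(1) by (simp only:) (intro measure_pmf.finite_measure_subadditive_finite, auto)
  also have "\<dots> \<le> (\<Sum>x\<in>X. c x)" by (intro sum_mono assms)
  finally show ?thesis .
qed

lemma prob_label_set_pmf:
  "measure_pmf.prob (label_set_pmf m p) {X. P X}
     = measure_pmf.prob (Pi_pmf {1..m} False (\<lambda>_. bernoulli_pmf p)) {b. P {i\<in>{1..m}. b i}}"
  by (simp add: label_set_pmf_def vimage_def)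

lemma prob_label_set_superset:
  assumes "A \<subseteq> {1..m}" "0 \<le> p" "p \<le> 1"
  shows "measure_pmf.prob (label_set_pmf m p) {X. A \<subseteq> X} = p ^ card A"
proof -
  have "{b. A \<subseteq> {i\<in>{1..m}. b i}} = {b. (\<forall>j\<in>A. b j) \<and> (\<forall>j\<in>{}. \<not> b j)}" using assms(1) by auto
  then show ?thesis
    unfolding prob_label_set_pmf
    using prob_Pi_bernoulli_pattern[of "{1..m}" A "{}" p] assms by simp
qed

lemma prob_label_set_mem_hit:
  assumes "A \<subseteq> {1..m}" "i \<in> {1..m}" "i \<notin> A" "0 \<le> p" "p \<le> 1"
  shows "measure_pmf.prob (label_set_pmf m p) {X. i \<in> X \<and> X \<inter> A \<noteq> {}} = p * (1 - (1 - p) ^ card A)"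
proof -
  let ?M = "label_set_pmf m p"
  have "measure_pmf.prob ?M {X. i \<in> X \<and> X \<inter> A \<noteq> {}}
      = measure_pmf.prob ?M ({X. i \<in> X} - {X. i \<in> X \<and> X \<inter> A = {}})"
    by (rule arg_cong[where f = "measure_pmf.prob ?M"]) auto
  also have "\<dots> = measure_pmf.prob ?M {X. i \<in> X} - measure_pmf.prob ?M {X. i \<in> X \<and> X \<inter> A = {}}"
    by (intro measure_pmf.finite_measure_Diff) auto
  also have "measure_pmf.prob ?M {X. i \<in> X} = p"
    using prob_label_set_superset[of "{i}" m p] assms by simp
  also have "measure_pmf.prob ?M {X. i \<in> X \<and> X \<inter> A = {}} = p * (1 - p) ^ card A"
  proof -
    have "{b. i \<in> {i\<in>{1..m}. b i} \<and> {i\<in>{1..m}. b i} \<inter> A = {}} = {b. (\<forall>j\<in>{i}. b j) \<and> (\<forall>j\<in>A. \<not> b j)}"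
      using assms(1,2) by (auto simp: disjoint_iff subset_iff)
    then show ?thesis
      unfolding prob_label_set_pmf
      using prob_Pi_bernoulli_pattern[of "{1..m}" "{i}" A p] assms by simp
  qed
  finally show ?thesis by (simp add: algebra_simps)
qed

lemma prob_label_set_hit_family_le:
  fixes A :: "'i \<Rightarrow> nat set" and y d p :: real
  assumes "finite I" and p: "0 \<le> p" "p \<le> 1" and y: "1 \<le> y" and d: "0 < d"
    and "\<And>a. a \<in> I \<Longrightarrow> A a \<subseteq> {1..m}"
    and "\<And>a. a \<in> I \<Longrightarrow> card (A a) \<le> K"
    and "\<And>j. j \<in> {1..m} \<Longrightarrow> real (card {a\<in>I. j \<in> A a}) \<le> d"
    and "\<And>k. k \<le> K \<Longrightarrow> (1 + p * (y - 1)) ^ k - (1 - p) ^ k \<le> 1"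
  shows "measure_pmf.prob (label_set_pmf m p) {X. \<forall>a\<in>I. X \<inter> A a \<noteq> {}} \<le> y powr (- real (card I) / d)"
proof -
  have "{b. \<forall>a\<in>I. {i\<in>{1..m}. b i} \<inter> A a \<noteq> {}} = {b. \<forall>a\<in>I. \<exists>j\<in>A a. b j}"
    using assms(6) by (fastforce simp: disjoint_iff)
  then show ?thesis
    unfolding prob_label_set_pmf using prob_hit_family_le[of "{1..m}" I p y d A K] assms by simp
qed

lemma prob_rig_component:
  assumes "v \<in> {1..n}"
  shows "measure_pmf.prob (rig_pmf n m p) {S. P (S v)} = measure_pmf.prob (label_set_pmf m p) {X. P X}"
proof -
  have "measure_pmf.prob (rig_pmf n m p) {S. P (S v)}
      = measure_pmf.prob (map_pmf (\<lambda>S. S v) (rig_pmf n m p)) {X. P X}"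
    by (simp add: vimage_def)
  then show ?thesis using assms by (simp add: rig_pmf_def Pi_pmf_component)
qed

lemma prob_rig_superset:
  assumes "F \<subseteq> {1..n}" "\<And>w. w \<in> F \<Longrightarrow> A w \<subseteq> {1..m}" "0 \<le> p" "p \<le> 1"
  shows "measure_pmf.prob (rig_pmf n m p) {S. \<forall>w\<in>F. A w \<subseteq> S w} = (\<Prod>w\<in>F. p ^ card (A w))"
proof -
  have fF: "finite F" using assms(1) finite_subset by blast
  have "{S. \<forall>w\<in>F. A w \<subseteq> S w} = Pi {1..n} (\<lambda>w. if w \<in> F then {X. A w \<subseteq> X} else UNIV)"
    using assms(1) by (auto simp: Pi_iff subset_iff split: if_splits)
  then have "measure_pmf.prob (rig_pmf n m p) {S. \<forall>w\<in>F. A w \<subseteq> S w}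
      = (\<Prod>w\<in>{1..n}. measure_pmf.prob (label_set_pmf m p) (if w \<in> F then {X. A w \<subseteq> X} else UNIV))"
    unfolding rig_pmf_def by (simp only: measure_Pi_pmf_Pi finite_atLeastAtMost)
  also have "\<dots> = (\<Prod>w\<in>{1..n}. if w \<in> F then p ^ card (A w) else 1)"
    using assms by (intro prod.cong) (auto simp: prob_label_set_superset)
  also have "\<dots> = (\<Prod>w\<in>F. p ^ card (A w))"
    using assms(1) by (simp add: prod.If_cases Int_absorb1)
  finally show ?thesis .
qed

section \<open>Typical events for the dense regime\<close>

text \<open>Chernoff with \<open>z = exp 1\<close>: the mean is m p \<le> C / p, and exp 1 - 1 \<le>
  2 makes the exponent at most (2 C - B) / p \<le> - 1 / p.\<close>

lemma prob_large_label_set_le: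
  assumes "0 < p" "p \<le> 1" "real m * p\<^sup>2 \<le> C" "2 * C + 1 \<le> B"
  shows "measure_pmf.prob (rig_pmf n m p) {S. \<exists>v\<in>{1..n}. B / p \<le> real (card (S v \<inter> {1..m}))}
           \<le> real n * exp (- 1 / p)"
proof -
  have "measure_pmf.prob (rig_pmf n m p) {S. \<exists>v\<in>{1..n}. B / p \<le> real (card (S v \<inter> {1..m}))}
      \<le> (\<Sum>v\<in>{1..n}. exp (- 1 / p))"
  proof (rule prob_Bex_le)
    fix v assume v: "v \<in> {1..n}"
    have q: "measure_pmf.prob (bernoulli_pmf p) {x. x} \<le> p"
    proof -
      have "{x. x} = {True}" by auto
      then show ?thesis using assms by (simp add: measure_pmf_single)
    qed
    have C0: "0 \<le> C" using assms(3) by (rule order.trans[rotated]) simp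
    have e: "exp (1::real) - 1 \<le> 2" using exp_le by simp
    have "measure_pmf.prob (rig_pmf n m p) {S. B / p \<le> real (card (S v \<inter> {1..m}))}
        = measure_pmf.prob (Pi_pmf {1..m} False (\<lambda>_. bernoulli_pmf p)) {b. B / p \<le> real (card {i\<in>{1..m}. b i})}"
    proof -
      have *: "{i\<in>{1..m}. b i} \<inter> {1..m} = {i\<in>{1..m}. b i}" for b by auto
      show ?thesis
        using prob_rig_component[OF v, of m p "\<lambda>X. B / p \<le> real (card (X \<inter> {1..m}))"]
        unfolding prob_label_set_pmf * by simp
    qed
    also have "\<dots> \<le> exp ((exp 1 - 1) * real (card {1..m}) * p - B / p * ln (exp 1))"
      using q by (intro chernoff_upper) auto
    also have "\<dots> \<le> exp (- 1 / p)"
    proof -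
      have mp: "real m * p \<le> C / p" using assms by (simp add: field_simps power2_eq_square)
      have "(exp 1 - 1) * (real m * p) \<le> 2 * (C / p)"
        using e mp assms C0 by (intro mult_mono) auto
      moreover have "(2 * C + 1) / p \<le> B / p" using assms by (intro divide_right_mono) auto
      ultimately show ?thesis by (simp add: add_divide_distrib mult.assoc)
    qed
    finally show "measure_pmf.prob (rig_pmf n m p) {S. B / p \<le> real (card (S v \<inter> {1..m}))} \<le> exp (- 1 / p)" .
  qed auto
  then show ?thesis by simp
qed

text \<open>A vertex carries two given labels with probability p^2. The parameter \<open>z\<close>
  stays free because it will be a power of \<open>n\<close>, which lets \<open>D\<close> be
  polynomially smaller than n p.\<close>

lemma prob_label_class_Int_ge_le:
  assumes "0 \<le> p" "p \<le> 1" "1 \<le> z"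
  shows "measure_pmf.prob (rig_pmf n m p)
      {S. \<exists>(i, j)\<in>{(i, j). i \<in> {1..m} \<and> j \<in> {1..m} \<and> i \<noteq> j}. D \<le> real (card {v\<in>{1..n}. i \<in> S v \<and> j \<in> S v})}
           \<le> (real m)\<^sup>2 * exp ((z - 1) * real n * p\<^sup>2 - D * ln z)"
proof -
  let ?X = "{(i, j). i \<in> {1..m} \<and> j \<in> {1..m} \<and> i \<noteq> j}" and ?c = "exp ((z - 1) * real n * p\<^sup>2 - D * ln z)"
  have sub: "?X \<subseteq> {1..m} \<times> {1..m}" by auto
  then have fX: "finite ?X" by (rule finite_subset) auto
  have "measure_pmf.prob (rig_pmf n m p)
      {S. \<exists>x\<in>?X. (case x of (i, j) \<Rightarrow> D \<le> real (card {v\<in>{1..n}. i \<in> S v \<and> j \<in> S v}))} \<le> (\<Sum>x\<in>?X. ?c)"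
  proof (rule prob_Bex_le[OF fX])
    fix x assume "x \<in> ?X"
    then obtain i j where x: "x = (i, j)" "i \<in> {1..m}" "j \<in> {1..m}" "i \<noteq> j" by auto
    have "{X. i \<in> X \<and> j \<in> X} = {X. {i, j} \<subseteq> X}" by auto
    then have "measure_pmf.prob (label_set_pmf m p) {X. i \<in> X \<and> j \<in> X} = p\<^sup>2"
      using prob_label_set_superset[of "{i, j}" m p] x assms by (simp add: power2_eq_square)
    then have "measure_pmf.prob (rig_pmf n m p) {S. D \<le> real (card {v\<in>{1..n}. i \<in> S v \<and> j \<in> S v})}
        \<le> exp ((z - 1) * real (card {1..n}) * p\<^sup>2 - D * ln z)"
      unfolding rig_pmf_def using assms by (intro chernoff_upper) auto
    then show "measure_pmf.prob (rig_pmf n m p)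
        {S. case x of (i, j) \<Rightarrow> D \<le> real (card {v\<in>{1..n}. i \<in> S v \<and> j \<in> S v})} \<le> ?c"
      by (simp add: x)
  qed
  also have "\<dots> = real (card ?X) * ?c" by simp
  also have "\<dots> \<le> real (card ({1..m} \<times> {1..m})) * ?c"
    using sub by (intro mult_right_mono of_nat_mono card_mono) auto
  finally show ?thesis by (simp add: power2_eq_square)
qed

lemma prob_label_class_small_le:
  assumes "0 \<le> p" "p \<le> 1" "0 < r" "r \<le> 1" "i \<in> {1..m}"
  shows "measure_pmf.prob (rig_pmf n m p) {S. real (card (label_class n S i)) \<le> r * (real n * p)}
           \<le> exp (((r - 1) - r * ln r) * (real n * p))"
proof -
  have "measure_pmf.prob (label_set_pmf m p) {X. i \<in> X} = p"
    using prob_label_set_superset[of "{i}" m p] assms by simp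
  then have "measure_pmf.prob (rig_pmf n m p) {S. real (card {v\<in>{1..n}. i \<in> S v}) \<le> r * (real n * p)}
      \<le> exp ((r - 1) * real (card {1..n}) * p - r * (real n * p) * ln r)"
    unfolding rig_pmf_def using assms by (intro chernoff_lower) auto
  then show ?thesis by (simp add: label_class_def algebra_simps)
qed

text \<open>Given \<open>S v\<close> with at most B / p labels, none of them \<open>i\<close>, any
  other vertex carries \<open>i\<close> and meets \<open>S v\<close> with probability at most p q.
  The count thus has mean at most q n p, and Chernoff with \<open>z = r / q\<close> bounds the
  chance of reaching r n p.\<close>

lemma prob_many_neighbours_in_class_le:
  assumes p: "0 < p" "p \<le> 1/2" and qr: "q = 1 - exp (- 2 * B)" "0 < q" "q \<le> r"
  shows "measure_pmf.prob (rig_pmf n m p)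
      {S. \<exists>(i, v)\<in>{1..m} \<times> {1..n}. i \<notin> S v \<and> real (card (S v \<inter> {1..m})) \<le> B / p \<and>
          r * (real n * p) \<le> real (card {u\<in>{1..n}. i \<in> S u \<and> S u \<inter> (S v \<inter> {1..m}) \<noteq> {}})}
      \<le> real m * real n * exp (((r / q - 1) * q - r * ln (r / q)) * (real n * p))"
proof -
  let ?M = "rig_pmf n m p" and ?c = "exp (((r / q - 1) * q - r * ln (r / q)) * (real n * p))"
  let ?E = "\<lambda>i v S. i \<notin> S v \<and> real (card (S v \<inter> {1..m})) \<le> B / p \<and>
          r * (real n * p) \<le> real (card {u\<in>{1..n}. i \<in> S u \<and> S u \<inter> (S v \<inter> {1..m}) \<noteq> {}})"
  have "measure_pmf.prob ?M {S. \<exists>x\<in>{1..m} \<times> {1..n}. (case x of (i, v) \<Rightarrow> ?E i v S)}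
      \<le> (\<Sum>x\<in>{1..m} \<times> {1..n}. ?c)"
  proof (rule prob_Bex_le)
    fix x assume "x \<in> {1..m} \<times> {1..n}"
    then obtain i v where x: "x = (i, v)" "i \<in> {1..m}" "v \<in> {1..n}" by auto
    have "measure_pmf.prob (Pi_pmf {1..n} {} (\<lambda>_. label_set_pmf m p)) {S. ?E i v S} \<le> ?c"
    proof (rule prob_Pi_pmf_cond_le[where A = "{v}"])
      fix s :: "nat \<Rightarrow> nat set"
      let ?N = "Pi_pmf ({1..n} - {v}) {} (\<lambda>_. label_set_pmf m p)"
      let ?m = "\<lambda>t x. if x \<in> {v} then s x else t x"
      define A where "A = s v \<inter> {1..m}"
      show "measure_pmf.prob ?N {t. ?E i v (?m t)} \<le> ?c"
      proof (cases "i \<notin> s v \<and> real (card A) \<le> B / p")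
        case False
        then have "{t. ?E i v (?m t)} = {}" by (auto simp: A_def)
        then show ?thesis by (simp only: measure_empty exp_ge_zero)
      next
        case True
        have "measure_pmf.prob (label_set_pmf m p) {X. i \<in> X \<and> X \<inter> A \<noteq> {}} \<le> p * q"
        proof -
          have "measure_pmf.prob (label_set_pmf m p) {X. i \<in> X \<and> X \<inter> A \<noteq> {}} = p * (1 - (1 - p) ^ card A)"
            using True x p by (intro prob_label_set_mem_hit) (auto simp: A_def)
          also have "\<dots> \<le> p * q"
            using one_minus_power_ge_exp[of p "card A" B] True p by (intro mult_left_mono) (auto simp: qr(1))
          finally show ?thesis .
        qed
        have "measure_pmf.prob ?N {t. ?E i v (?m t)}
            \<le> measure_pmf.prob ?N {t. r * (real n * p) \<le> real (card {u\<in>{1..n} - {v}. i \<in> t u \<and> t u \<inter> A \<noteq> {}})}"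
        proof (intro measure_pmf.finite_measure_mono subsetI CollectI)
          fix t assume "t \<in> {t. ?E i v (?m t)}"
          then have "r * (real n * p) \<le> real (card {u\<in>{1..n}. i \<in> ?m t u \<and> ?m t u \<inter> A \<noteq> {}})"
            by (simp add: A_def)
          \<comment> \<open>As \<open>i\<close> is not in \<open>s v\<close>, the vertex
            \<open>v\<close> is not counted, and only coordinates independent of \<open>s v\<close>
            remain.\<close>
          also have "{u\<in>{1..n}. i \<in> ?m t u \<and> ?m t u \<inter> A \<noteq> {}} = {u\<in>{1..n} - {v}. i \<in> t u \<and> t u \<inter> A \<noteq> {}}"
            using True by auto
          finally show "r * (real n * p) \<le> real (card {u\<in>{1..n} - {v}. i \<in> t u \<and> t u \<inter> A \<noteq> {}})" .
        qed simp
        also have "\<dots> \<le> exp ((r / q - 1) * real (card ({1..n} - {v})) * (p * q) - r * (real n * p) * ln (r / q))"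
          using \<open>_ \<le> p * q\<close> qr by (intro chernoff_upper) auto
        also have "\<dots> \<le> exp ((r / q - 1) * real n * (p * q) - r * (real n * p) * ln (r / q))"
        proof -
          have "card ({1..n} - {v}) \<le> n" using card_mono[of "{1..n}" "{1..n} - {v}"] by simp
          then have "(r / q - 1) * real (card ({1..n} - {v})) * (p * q) \<le> (r / q - 1) * real n * (p * q)"
            using qr p by (intro mult_right_mono mult_left_mono) auto
          then show ?thesis by simp
        qed
        also have "\<dots> = ?c" by (simp add: algebra_simps)
        finally show ?thesis .
      qed
    qed (use x in auto)
    then show "measure_pmf.prob ?M {S. case x of (i, v) \<Rightarrow> ?E i v S} \<le> ?c"
      by (simp add: x rig_pmf_def)
  qed auto
  then show ?thesis by (simp add: case_prod_beta')
qed

section \<open>The sparse regime and its forbidden configurations\<close>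

lemma rig_pmf_labels:
  assumes "S \<in> set_pmf (rig_pmf n m p)"
  shows "S v \<subseteq> {1..m}"
proof (cases "v \<in> {1..n}")
  case True
  then have "S v \<in> set_pmf (label_set_pmf m p)"
    using assms by (auto simp: rig_pmf_def set_Pi_pmf PiE_dflt_def)
  then show ?thesis by (auto simp: label_set_pmf_def)
next
  case False
  then have "S v = {}" using assms by (auto simp: rig_pmf_def set_Pi_pmf PiE_dflt_def)
  then show ?thesis by simp
qed

text \<open>Deterministic implications need to hold only for assignments of positive probability,
  where all label sets lie in {1..m}.\<close>

lemma prob_mono_on_support:
  assumes "\<And>S. S \<in> set_pmf M \<Longrightarrow> P S \<Longrightarrow> R S"
  shows "measure_pmf.prob M {S. P S} \<le> measure_pmf.prob M {S. R S}"
proof -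
  have "measure_pmf.prob M {S. P S} = measure_pmf.prob M ({S. P S} \<inter> set_pmf M)"
    by (simp add: measure_Int_set_pmf)
  also have "\<dots> \<le> measure_pmf.prob M {S. R S}"
    using assms by (intro measure_pmf.finite_measure_mono) auto
  finally show ?thesis .
qed

lemma prob_disj_le:
  "measure_pmf.prob M {S. P S \<or> R S} \<le> measure_pmf.prob M {S. P S} + measure_pmf.prob M {S. R S}"
proof -
  have "{S. P S \<or> R S} = {S. P S} \<union> {S. R S}" by auto
  then show ?thesis by (simp add: measure_Un_le)
qed

text \<open>First moment: at most n^2 m^2 quadruples, each realised with probability p^4.\<close>

lemma prob_shared_pair_le:
  assumes "0 \<le> p" "p \<le> 1"
  shows "measure_pmf.prob (rig_pmf n m p)
      {S. \<exists>(u, v, i, j)\<in>{(u, v, i, j). u \<in> {1..n} \<and> v \<in> {1..n} \<and> i \<in> {1..m} \<and> j \<in> {1..m} \<and> u \<noteq> v \<and> i \<noteq> j}.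
            {i, j} \<subseteq> S u \<inter> S v} \<le> (real n * real m * p\<^sup>2)\<^sup>2"
    (is "measure_pmf.prob _ {S. \<exists>(u, v, i, j)\<in>?X. _ u v i j S} \<le> _")
proof -
  have sub: "?X \<subseteq> {1..n} \<times> {1..n} \<times> {1..m} \<times> {1..m}" by auto
  then have fX: "finite ?X" by (rule finite_subset) auto
  have "measure_pmf.prob (rig_pmf n m p) {S. \<exists>x\<in>?X. (case x of (u, v, i, j) \<Rightarrow> {i, j} \<subseteq> S u \<inter> S v)}
      \<le> (\<Sum>x\<in>?X. p ^ 4)"
  proof (rule prob_Bex_le[OF fX])
    fix x assume "x \<in> ?X"
    then obtain u v i j where x: "x = (u, v, i, j)" "u \<in> {1..n}" "v \<in> {1..n}" "i \<in> {1..m}" "j \<in> {1..m}"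
      "u \<noteq> v" "i \<noteq> j" by auto
    have "{S. {i, j} \<subseteq> S u \<inter> S v} = {S. \<forall>w\<in>{u, v}. {i, j} \<subseteq> S w}" by auto
    then have "measure_pmf.prob (rig_pmf n m p) {S. {i, j} \<subseteq> S u \<inter> S v} = (\<Prod>w\<in>{u, v}. p ^ card {i, j})"
      using prob_rig_superset[of "{u, v}" n "\<lambda>_. {i, j}" m p] x assms by simp
    also have "\<dots> = p ^ 4" using x by (simp add: power4_eq_xxxx power2_eq_square mult_ac)
    finally show "measure_pmf.prob (rig_pmf n m p) {S. case x of (u, v, i, j) \<Rightarrow> {i, j} \<subseteq> S u \<inter> S v} \<le> p ^ 4"
      by (simp add: x)
  qed
  also have "\<dots> = real (card ?X) * p ^ 4" by simp
  also have "\<dots> \<le> real (card ({1..n} \<times> {1..n} \<times> {1..m} \<times> {1..m})) * p ^ 4"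
    using sub assms by (intro mult_right_mono of_nat_mono card_mono) auto
  finally show ?thesis by (simp add: power2_eq_square power4_eq_xxxx mult_ac)
qed

text \<open>First moment: three vertices, each required to carry two of three labels, contribute n^3
  m^3 p^6.\<close>

lemma prob_rainbow_triangle_le:
  assumes "0 \<le> p" "p \<le> 1"
  shows "measure_pmf.prob (rig_pmf n m p)
      {S. \<exists>(u, v, w, i, j, k)\<in>{(u, v, w, i, j, k). u \<in> {1..n} \<and> v \<in> {1..n} \<and> w \<in> {1..n} \<and>
              i \<in> {1..m} \<and> j \<in> {1..m} \<and> k \<in> {1..m} \<and> distinct [u, v, w] \<and> distinct [i, j, k]}.
            {i, k} \<subseteq> S u \<and> {i, j} \<subseteq> S v \<and> {j, k} \<subseteq> S w} \<le> (real n * real m * p\<^sup>2) ^ 3"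
    (is "measure_pmf.prob _ {S. \<exists>(u, v, w, i, j, k)\<in>?X. _ u v w i j k S} \<le> _")
proof -
  let ?E = "\<lambda>S (u, v, w, i, j, k). {i, k} \<subseteq> S u \<and> {i, j} \<subseteq> S v \<and> {j, k} \<subseteq> S w"
  have sub: "?X \<subseteq> {1..n} \<times> {1..n} \<times> {1..n} \<times> {1..m} \<times> {1..m} \<times> {1..m}" by auto
  then have fX: "finite ?X" by (rule finite_subset) auto
  have "measure_pmf.prob (rig_pmf n m p) {S. \<exists>x\<in>?X. ?E S x} \<le> (\<Sum>x\<in>?X. p ^ 6)"
  proof (rule prob_Bex_le[OF fX])
    fix x assume "x \<in> ?X"
    then obtain u v w i j k where x: "x = (u, v, w, i, j, k)" "u \<in> {1..n}" "v \<in> {1..n}" "w \<in> {1..n}"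
      "i \<in> {1..m}" "j \<in> {1..m}" "k \<in> {1..m}" "distinct [u, v, w]" "distinct [i, j, k]" by auto
    define A where "A z = (if z = u then {i, k} else if z = v then {i, j} else {j, k})" for z
    have "{S. {i, k} \<subseteq> S u \<and> {i, j} \<subseteq> S v \<and> {j, k} \<subseteq> S w} = {S. \<forall>z\<in>{u, v, w}. A z \<subseteq> S z}"
      using x by (auto simp: A_def)
    then have "measure_pmf.prob (rig_pmf n m p) {S. {i, k} \<subseteq> S u \<and> {i, j} \<subseteq> S v \<and> {j, k} \<subseteq> S w}
        = (\<Prod>z\<in>{u, v, w}. p ^ card (A z))"
      using prob_rig_superset[of "{u, v, w}" n A m p] x assms by (simp add: A_def)
    also have "\<dots> = p ^ 6" using x by (simp add: A_def eval_nat_numeral mult_ac)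
    finally show "measure_pmf.prob (rig_pmf n m p) {S. ?E S x} \<le> p ^ 6"
      by (simp add: x)
  qed
  also have "\<dots> = real (card ?X) * p ^ 6" by simp
  also have "\<dots> \<le> real (card ({1..n} \<times> {1..n} \<times> {1..n} \<times> {1..m} \<times> {1..m} \<times> {1..m})) * p ^ 6"
    using sub assms by (intro mult_right_mono of_nat_mono card_mono) auto
  also have "\<dots> = (real n * real m * p\<^sup>2) ^ 3" by (simp add: eval_nat_numeral mult_ac)
  finally show ?thesis by simp
qed

text \<open>A clique outside every label class contains \<open>a\<close>, \<open>b\<close> sharing a
  label \<open>i\<close>, and some \<open>v\<close> without \<open>i\<close>. Let \<open>j\<close>
  join \<open>a\<close> to \<open>v\<close> and \<open>k\<close> join \<open>b\<close> to
  \<open>v\<close>. If j = k, then \<open>a\<close> and \<open>b\<close> share two labels; otherwise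
  \<open>a\<close>, \<open>b\<close>, \<open>v\<close> form a triangle with three distinct
  labels.\<close>

lemma prob_sparse_non_single_label_le:
  assumes "0 \<le> p" "p \<le> 1"
  shows "measure_pmf.prob (rig_pmf n m p) {S. \<exists>Q. clique n S Q \<and> 2 \<le> card Q \<and> \<not> single_label n m S Q}
           \<le> (real n * real m * p\<^sup>2)\<^sup>2 + (real n * real m * p\<^sup>2) ^ 3"
proof (rule order.trans[OF prob_mono_on_support
      order.trans[OF prob_disj_le add_mono[OF prob_shared_pair_le[OF assms] prob_rainbow_triangle_le[OF assms]]]])
  fix S assume S: "S \<in> set_pmf (rig_pmf n m p)"
  assume "\<exists>Q. clique n S Q \<and> 2 \<le> card Q \<and> \<not> single_label n m S Q"
  then obtain Q where Q: "clique n S Q" "2 \<le> card Q" "\<not> single_label n m S Q" by blast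
  note lab = rig_pmf_labels[OF S]
  have QV: "Q \<subseteq> {1..n}" and adj: "S u \<inter> S v \<noteq> {}" if "u \<in> Q" "v \<in> Q" "u \<noteq> v" for u v
    using Q(1) that by (auto simp: clique_def adjacent_def)
  obtain a b where ab: "a \<in> Q" "b \<in> Q" "a \<noteq> b"
    using Q(2) card_le_Suc0_iff_eq[of Q] by (metis card.infinite not_less_eq_eq numeral_2_eq_2 zero_le)
  note QV = QV[OF ab]
  obtain i where i: "i \<in> S a" "i \<in> S b" using adj[OF ab] by auto
  have "i \<in> {1..m}" using subsetD[OF lab i(1)] .
  then have "\<not> Q \<subseteq> label_class n S i" using Q(3) by (auto simp: single_label_def)
  then obtain v where v: "v \<in> Q" "i \<notin> S v" using QV by (auto simp: label_class_def)
  have ne: "v \<noteq> a" "v \<noteq> b" using v i by auto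
  obtain j where j: "j \<in> S a" "j \<in> S v" using adj[of a v] ab v ne by auto
  obtain k where k: "k \<in> S b" "k \<in> S v" using adj[of b v] ab v ne by auto
  have rng: "a \<in> {1..n}" "b \<in> {1..n}" "v \<in> {1..n}" "i \<in> {1..m}" "j \<in> {1..m}" "k \<in> {1..m}"
    using QV ab v i j k lab by blast+
  have ij: "i \<noteq> j" "i \<noteq> k" using v j k by auto
  show "(\<exists>(u, v, i, j)\<in>{(u, v, i, j). u \<in> {1..n} \<and> v \<in> {1..n} \<and> i \<in> {1..m} \<and> j \<in> {1..m} \<and> u \<noteq> v \<and> i \<noteq> j}.
            {i, j} \<subseteq> S u \<inter> S v) \<or>
        (\<exists>(u, v, w, i, j, k)\<in>{(u, v, w, i, j, k). u \<in> {1..n} \<and> v \<in> {1..n} \<and> w \<in> {1..n} \<and>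
              i \<in> {1..m} \<and> j \<in> {1..m} \<and> k \<in> {1..m} \<and> distinct [u, v, w] \<and> distinct [i, j, k]}.
            {i, k} \<subseteq> S u \<and> {i, j} \<subseteq> S v \<and> {j, k} \<subseteq> S w)"
  proof (cases "j = k")
    case True
    then show ?thesis using rng ij ab i j k by (intro disjI1 bexI[of _ "(a, b, i, j)"]) auto
  next
    case False
    then show ?thesis using rng ij ab ne i j k by (intro disjI2 bexI[of _ "(b, a, v, i, j, k)"]) auto
  qed
qed

section \<open>Pairs of vertex sets joined by light labels\<close>

text \<open>Lightness is measured on \<open>T\<close> alone: which labels are light is then
  determined by the label sets on \<open>T\<close> and stays fixed while those on \<open>W\<close>
  are drawn.\<close>

definition light_joined :: "nat \<Rightarrow> (nat \<Rightarrow> nat set) \<Rightarrow> real \<Rightarrow> nat set \<Rightarrow> nat set \<Rightarrow> bool" where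
  "light_joined m S d T W \<longleftrightarrow>
     (\<forall>t\<in>T. \<forall>w\<in>W. \<exists>j\<in>{1..m}. j \<in> S t \<inter> S w \<and> real (card {v\<in>T. j \<in> S v}) \<le> d)"

text \<open>Freeze all label sets outside \<open>W\<close>. Each vertex of \<open>W\<close> must
  hit, for every \<open>t\<close> in \<open>T\<close>, the set of light labels of \<open>t\<close>;
  these sets have at most B / p elements and no label lies in more than \<open>d\<close> of them, so
  the hitting bound applies. Independence over \<open>W\<close> gives the outer power.\<close>

lemma prob_light_joined_le:
  fixes B d p :: real
  assumes T: "T \<subseteq> {1..n}" and W: "W \<subseteq> {1..n}" and TW: "T \<inter> W = {}"
    and p: "0 < p" "p \<le> 1/2" and B: "0 < B" and d: "0 < d"
  shows "measure_pmf.prob (rig_pmf n m p)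
      {S. (\<forall>t\<in>T. real (card (S t \<inter> {1..m})) \<le> B / p) \<and> light_joined m S d T W}
      \<le> ((1 + ln (1 + exp (- 2 * B)) / B) powr (- real (card T) / d)) ^ card W"
proof -
  define y where "y = 1 + ln (1 + exp (- 2 * B)) / B"
  have y: "1 \<le> y" using B by (simp add: y_def)
  have fT: "finite T" and fW: "finite W" using T W finite_subset by blast+
  let ?c = "(y powr (- real (card T) / d)) ^ card W"
  let ?E = "\<lambda>S. (\<forall>t\<in>T. real (card (S t \<inter> {1..m})) \<le> B / p) \<and> light_joined m S d T W"
  have "measure_pmf.prob (Pi_pmf {1..n} {} (\<lambda>_. label_set_pmf m p)) {S. ?E S} \<le> ?c"
  proof (rule prob_Pi_pmf_cond_le[where A = "{1..n} - W"])
    fix s :: "nat \<Rightarrow> nat set"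
    let ?m = "\<lambda>r x. if x \<in> {1..n} - W then s x else r x"
    have VW: "{1..n} - ({1..n} - W) = W" using W by auto
    define A where "A t = {j\<in>s t \<inter> {1..m}. real (card {v\<in>T. j \<in> s v}) \<le> d}" for t
    have mT: "?m r t = s t" if "t \<in> T" for r t using that T TW by auto
    have mW: "?m r w = r w" if "w \<in> W" for r w using that by auto
    show "measure_pmf.prob (Pi_pmf ({1..n} - ({1..n} - W)) {} (\<lambda>_. label_set_pmf m p)) {r. ?E (?m r)} \<le> ?c"
      unfolding VW
    proof (cases "\<forall>t\<in>T. real (card (s t \<inter> {1..m})) \<le> B / p")
      case False
      then have "{r. ?E (?m r)} = {}" using mT by fastforce
      then show "measure_pmf.prob (Pi_pmf W {} (\<lambda>_. label_set_pmf m p)) {r. ?E (?m r)} \<le> ?c"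
        by (simp only: measure_empty) simp
    next
      case True
      have "measure_pmf.prob (label_set_pmf m p) {X. \<forall>t\<in>T. X \<inter> A t \<noteq> {}} \<le> y powr (- real (card T) / d)"
      proof (rule prob_label_set_hit_family_le)
        show "card (A t) \<le> nat \<lfloor>B / p\<rfloor>" if "t \<in> T" for t
        proof -
          have "card (A t) \<le> card (s t \<inter> {1..m})" by (intro card_mono) (auto simp: A_def)
          also have "\<dots> \<le> nat \<lfloor>B / p\<rfloor>" using True that by (intro le_nat_floor) auto
          finally show ?thesis .
        qed
        show "real (card {t\<in>T. j \<in> A t}) \<le> d" for j
        proof (cases "real (card {v\<in>T. j \<in> s v}) \<le> d")
          case True
          have "card {t\<in>T. j \<in> A t} \<le> card {v\<in>T. j \<in> s v}"
            using fT by (intro card_mono) (auto simp: A_def)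
          then show ?thesis using True by linarith
        next
          case False
          then have "{t\<in>T. j \<in> A t} = {}" by (auto simp: A_def)
          then show ?thesis using d by (simp only:) simp
        qed
        show "(1 + p * (y - 1)) ^ k - (1 - p) ^ k \<le> 1" if "k \<le> nat \<lfloor>B / p\<rfloor>" for k
        proof -
          have "0 \<le> B / p" using B p by simp
          then have "real k \<le> B / p" using that by linarith
          then show ?thesis using hit_moment_le_one[of p B k] p B by (simp add: y_def)
        qed
      qed (use fT p y d in \<open>auto simp: A_def\<close>)
      note hit = this
      have "measure_pmf.prob (Pi_pmf W {} (\<lambda>_. label_set_pmf m p)) {r. ?E (?m r)}
          \<le> measure_pmf.prob (Pi_pmf W {} (\<lambda>_. label_set_pmf m p)) (Pi W (\<lambda>_. {X. \<forall>t\<in>T. X \<inter> A t \<noteq> {}}))"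
      proof (intro measure_pmf.finite_measure_mono subsetI Pi_I CollectI ballI)
        fix r w t assume r: "r \<in> {r. ?E (?m r)}" and w: "w \<in> W" and t: "t \<in> T"
        have deg: "{v\<in>T. j \<in> ?m r v} = {v\<in>T. j \<in> s v}" for j using T TW by auto
        obtain j where "j \<in> {1..m}" "j \<in> ?m r t \<inter> ?m r w" "real (card {v\<in>T. j \<in> ?m r v}) \<le> d"
          using r w t unfolding light_joined_def by blast
        then have "j \<in> r w \<inter> A t" unfolding mT[OF t] mW[OF w] deg by (auto simp: A_def)
        then show "r w \<inter> A t \<noteq> {}" by blast
      qed simp
      also have "\<dots> = measure_pmf.prob (label_set_pmf m p) {X. \<forall>t\<in>T. X \<inter> A t \<noteq> {}} ^ card W"
        using fW by (simp add: measure_Pi_pmf_Pi)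
      also have "\<dots> \<le> ?c" using hit by (intro power_mono) auto
      finally show "measure_pmf.prob (Pi_pmf W {} (\<lambda>_. label_set_pmf m p)) {r. ?E (?m r)} \<le> ?c" .
    qed
  qed auto
  then show ?thesis by (simp add: rig_pmf_def y_def)
qed

lemma sum_power_card_Pow:
  fixes x :: real
  assumes "finite V"
  shows "(\<Sum>T\<in>Pow V. x ^ card T) = (1 + x) ^ card V"
  using prod_add[OF assms, of "\<lambda>_. x" "\<lambda>_. 1"] by (simp add: add.commute)

text \<open>Only \<open>card W\<close> needs a lower bound relative to the other set: it is the
  exponent of the probability bound, which has to pay for the choice of both sets.\<close>

definition joined_pairs :: "nat \<Rightarrow> real \<Rightarrow> (nat set \<times> nat set) set" where
  "joined_pairs n \<eta> = {(T, W). T \<subseteq> {1..n} \<and> W \<subseteq> {1..n} \<and> T \<inter> W = {} \<and> T \<noteq> {} \<and> \<eta> * real (card T) \<le> real (card W)}"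

text \<open>\<gamma> is chosen so that one vertex of \<open>W\<close> succeeds with probability at
  most n^(-K), where K = 2 / \<eta> + 2. By \<open>card W\<close> \<ge> \<eta> *
  \<open>card T\<close> the resulting power is at most n^(-2 \<open>card T\<close> - 2
  \<open>card W\<close>), and the sum over all pairs factorises.\<close>

lemma prob_ex_light_joined_le:
  fixes B \<eta> p :: real
  assumes n: "2 \<le> n" and p: "0 < p" "p \<le> 1/2" and B: "0 < B" and \<eta>: "0 < \<eta>"
  defines "\<gamma> \<equiv> ln (1 + ln (1 + exp (- 2 * B)) / B) / (2 / \<eta> + 2)"
  shows "measure_pmf.prob (rig_pmf n m p) {S. \<exists>(T, W)\<in>joined_pairs n \<eta>.
       (\<forall>t\<in>T. real (card (S t \<inter> {1..m})) \<le> B / p) \<and> light_joined m S (\<gamma> * real (card T) / ln (real n)) T W}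
      \<le> (exp (1 / real n) - 1) * exp (1 / real n)"
proof -
  define y where "y = 1 + ln (1 + exp (- 2 * B)) / B"
  define K where "K = 2 / \<eta> + 2"
  define x where "x = 1 / (real n)\<^sup>2"
  have y: "1 < y" using B by (simp add: y_def add_pos_pos)
  have K: "0 < K" using \<eta> by (simp add: K_def add_pos_pos)
  have \<gamma>: "0 < \<gamma>" "\<gamma> = ln y / K" using y K by (auto simp: \<gamma>_def y_def K_def)
  have ln: "0 < ln (real n)" using n by simp
  let ?E = "\<lambda>T W S. (\<forall>t\<in>T. real (card (S t \<inter> {1..m})) \<le> B / p) \<and> light_joined m S (\<gamma> * real (card T) / ln (real n)) T W"
  have sub: "joined_pairs n \<eta> \<subseteq> (Pow {1..n} - {{}}) \<times> Pow {1..n}" by (auto simp: joined_pairs_def)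
  then have fin: "finite (joined_pairs n \<eta>)" by (rule finite_subset) auto
  have "measure_pmf.prob (rig_pmf n m p) {S. \<exists>x\<in>joined_pairs n \<eta>. (case x of (T, W) \<Rightarrow> ?E T W S)}
      \<le> (\<Sum>(T, W)\<in>joined_pairs n \<eta>. x ^ card T * x ^ card W)"
  proof (rule prob_Bex_le[OF fin])
    fix z assume "z \<in> joined_pairs n \<eta>"
    then obtain T W where z: "z = (T, W)" "T \<subseteq> {1..n}" "W \<subseteq> {1..n}" "T \<inter> W = {}" "T \<noteq> {}"
      "\<eta> * real (card T) \<le> real (card W)" by (auto simp: joined_pairs_def)
    have "finite T" using z finite_subset by blast
    then have cT: "0 < real (card T)" using z by (simp add: card_gt_0_iff)
    have "0 < \<gamma> * real (card T) / ln (real n)" using \<gamma>(1) cT ln by simp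
    then have "measure_pmf.prob (rig_pmf n m p) {S. ?E T W S}
        \<le> (y powr (- real (card T) / (\<gamma> * real (card T) / ln (real n)))) ^ card W"
      unfolding y_def using z p B by (intro prob_light_joined_le)
    also have "y powr (- real (card T) / (\<gamma> * real (card T) / ln (real n))) = real n powr (- K)"
    proof -
      have "ln y / \<gamma> = K" using y K \<gamma>(2) by simp
      moreover have "- real (card T) / (\<gamma> * real (card T) / ln (real n)) = - ln (real n) / \<gamma>"
        using cT by simp
      ultimately show ?thesis using y n \<gamma>(1) by (simp add: powr_def field_simps)
    qed
    also have "(real n powr (- K)) ^ card W = real n powr (- K * real (card W))"
      using n by (simp add: powr_powr flip: powr_realpow)
    also have "\<dots> \<le> real n powr (- 2 * real (card T) - 2 * real (card W))"
    proof (rule powr_mono)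
      have "real (card T) * 2 \<le> real (card W) * 2 / \<eta>" using z \<eta> by (simp add: field_simps)
      then show "- K * real (card W) \<le> - 2 * real (card T) - 2 * real (card W)"
        by (simp add: K_def algebra_simps)
    qed (use n in auto)
    also have "\<dots> = x ^ card T * x ^ card W"
    proof -
      have "x = real n powr (- 2)" using n by (simp add: x_def powr_minus divide_inverse powr_numeral)
      moreover have "0 < x" using n by (simp add: x_def)
      ultimately have xk: "x ^ k = real n powr (- 2 * real k)" for k
        by (simp only: powr_realpow[symmetric] powr_powr)
      show ?thesis unfolding xk powr_add[symmetric] by simp
    qed
    finally show "measure_pmf.prob (rig_pmf n m p) {S. case z of (T, W) \<Rightarrow> ?E T W S}
        \<le> (case z of (T, W) \<Rightarrow> x ^ card T * x ^ card W)" by (simp add: z)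
  qed
  also have "\<dots> \<le> (\<Sum>(T, W)\<in>(Pow {1..n} - {{}}) \<times> Pow {1..n}. x ^ card T * x ^ card W)"
    using sub by (intro sum_mono2) (auto simp: x_def)
  also have "\<dots> = (\<Sum>T\<in>Pow {1..n} - {{}}. x ^ card T) * (\<Sum>W\<in>Pow {1..n}. x ^ card W)"
    by (simp add: sum_product sum.cartesian_product)
  \<comment> \<open>Leaving out the empty \<open>T\<close> removes the term 1; otherwise the bound
    would not tend to 0.\<close>
  also have "(\<Sum>T\<in>Pow {1..n} - {{}}. x ^ card T) = (1 + x) ^ n - 1"
    using sum_power_card_Pow[of "{1..n}" x] by (simp add: sum_diff1)
  also have "(\<Sum>W\<in>Pow {1..n}. x ^ card W) = (1 + x) ^ n"
    using sum_power_card_Pow[of "{1..n}" x] by simp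
  also have "((1 + x) ^ n - 1) * (1 + x) ^ n \<le> (exp (1 / real n) - 1) * exp (1 / real n)"
  proof -
    have x0: "0 \<le> x" by (simp add: x_def)
    have "(1 + x) ^ n \<le> exp x ^ n" using x0 by (intro power_mono) auto
    also have "\<dots> = exp (real n * x)" by (simp add: exp_of_nat_mult)
    also have "real n * x = 1 / real n" using n by (simp add: x_def power2_eq_square)
    finally have "(1 + x) ^ n \<le> exp (1 / real n)" .
    moreover have "1 \<le> (1 + x) ^ n" using x0 by simp
    ultimately show ?thesis by (intro mult_mono) auto
  qed
  finally show ?thesis .
qed

section \<open>Structure of large cliques\<close>

text \<open>Double counting of triples (v, i, j) with distinct \<open>i\<close>, \<open>j\<close> in
  \<open>H\<close> and in \<open>S v\<close>: by vertices on the left, by ordered label pairs on the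
  right.\<close>

lemma sum_label_pairs_le:
  fixes S :: "'v \<Rightarrow> 'l set" and D :: real
  assumes "finite Q" "finite H"
    and D: "\<And>i j. i \<in> H \<Longrightarrow> j \<in> H \<Longrightarrow> i \<noteq> j \<Longrightarrow> real (card {v\<in>Q. i \<in> S v \<and> j \<in> S v}) \<le> D"
    and "0 \<le> D"
  shows "(\<Sum>v\<in>Q. real (card (H \<inter> S v)) * (real (card (H \<inter> S v)) - 1)) \<le> (real (card H))\<^sup>2 * D"
proof -
  have e: "real (card (H \<inter> S v)) = (\<Sum>i\<in>H. of_bool (i \<in> S v))" for v
    using assms(2) by (simp add: of_bool_def sum.If_cases Int_def)
  have "real (card (H \<inter> S v)) * (real (card (H \<inter> S v)) - 1)
      = (\<Sum>i\<in>H. \<Sum>j\<in>H - {i}. of_bool (i \<in> S v \<and> j \<in> S v))" for v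
    unfolding e sum_distrib_right
  proof (intro sum.cong refl)
    fix i assume "i \<in> H"
    then have "(\<Sum>j\<in>H. of_bool (j \<in> S v)) = of_bool (i \<in> S v) + (\<Sum>j\<in>H - {i}. of_bool (j \<in> S v) :: real)"
      using assms(2) by (intro sum.remove)
    then show "of_bool (i \<in> S v) * ((\<Sum>j\<in>H. of_bool (j \<in> S v)) - 1)
        = (\<Sum>j\<in>H - {i}. of_bool (i \<in> S v \<and> j \<in> S v) :: real)"
      by simp
  qed
  then have "(\<Sum>v\<in>Q. real (card (H \<inter> S v)) * (real (card (H \<inter> S v)) - 1))
      = (\<Sum>v\<in>Q. \<Sum>i\<in>H. \<Sum>j\<in>H - {i}. of_bool (i \<in> S v \<and> j \<in> S v))"
    by simp
  also have "\<dots> = (\<Sum>i\<in>H. \<Sum>v\<in>Q. \<Sum>j\<in>H - {i}. of_bool (i \<in> S v \<and> j \<in> S v))"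
    by (rule sum.swap)
  also have "\<dots> = (\<Sum>i\<in>H. \<Sum>j\<in>H - {i}. \<Sum>v\<in>Q. of_bool (i \<in> S v \<and> j \<in> S v))"
    by (intro sum.cong refl sum.swap)
  also have "\<dots> = (\<Sum>i\<in>H. \<Sum>j\<in>H - {i}. real (card {v\<in>Q. i \<in> S v \<and> j \<in> S v}))"
    using assms(1) by (simp add: of_bool_def sum.If_cases Int_def)
  also have "\<dots> \<le> (\<Sum>i\<in>H. \<Sum>j\<in>H - {i}. D)"
    by (intro sum_mono D) auto
  also have "\<dots> \<le> (\<Sum>i\<in>H. \<Sum>j\<in>H. D)"
    using assms by (intro sum_mono sum_mono2) auto
  finally show ?thesis by (simp add: power2_eq_square mult_ac)
qed

text \<open>Without a dominant label, the vertices with at most one heavy label fall into classes of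
  size below (1 - 3 \<eta>) k, which can be grouped into two large sides that no heavy label joins.
  But \<open>split\<close> yields a pair across the sides all of whose common labels are heavy, and
  in a clique there is such a label.\<close>

lemma exists_dominant_label:
  fixes S :: "'v \<Rightarrow> 'l set" and Q :: "'v set" and c \<eta> D :: real
  assumes fin: "finite Q" "finite U" and k2: "2 \<le> card Q"
    and sub: "\<And>v. v \<in> Q \<Longrightarrow> S v \<subseteq> U"
    and meet: "\<And>u v. u \<in> Q \<Longrightarrow> v \<in> Q \<Longrightarrow> u \<noteq> v \<Longrightarrow> S u \<inter> S v \<noteq> {}"
    and D: "\<And>i j. i \<in> U \<Longrightarrow> j \<in> U \<Longrightarrow> i \<noteq> j \<Longrightarrow> real (card {v\<in>Q. i \<in> S v \<and> j \<in> S v}) \<le> D" "0 \<le> D"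
    and c: "0 < c" and \<eta>: "0 < \<eta>" "\<eta> \<le> 1/8"
    and small: "(2 / c + 1)\<^sup>2 * D \<le> \<eta> * real (card Q)"
    and split: "\<And>T W. T \<subseteq> Q \<Longrightarrow> W \<subseteq> Q \<Longrightarrow> T \<inter> W = {} \<Longrightarrow>
       \<eta> * real (card Q) \<le> real (card T) \<Longrightarrow> \<eta> * real (card Q) \<le> real (card W) \<Longrightarrow>
       \<exists>t\<in>T. \<exists>w\<in>W. \<forall>j\<in>S t \<inter> S w. c * real (card Q) < real (card {v\<in>Q. j \<in> S v})"
  shows "\<exists>i\<in>U. (1 - 3 * \<eta>) * real (card Q) \<le> real (card {v\<in>Q. i \<in> S v})"
proof (rule ccontr)
  assume none: "\<not> ?thesis"
  define k where "k = real (card Q)"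
  have k: "2 \<le> k" using k2 by (simp add: k_def)
  define H where "H = {j\<in>U. c * k < real (card {v\<in>Q. j \<in> S v})}"
  have fH: "finite H" using fin by (auto simp: H_def)
  have pairs: "(\<Sum>v\<in>Q. real (card (G \<inter> S v)) * (real (card (G \<inter> S v)) - 1)) \<le> \<eta> * k"
    if "G \<subseteq> H" "real (card G) \<le> 2 / c + 1" for G
  proof -
    have "(\<Sum>v\<in>Q. real (card (G \<inter> S v)) * (real (card (G \<inter> S v)) - 1)) \<le> (real (card G))\<^sup>2 * D"
      using that fH fin D by (intro sum_label_pairs_le) (auto simp: H_def intro: finite_subset)
    also have "\<dots> \<le> (2 / c + 1)\<^sup>2 * D"
      using that D by (intro mult_right_mono power_mono) auto
    finally show ?thesis using small by (simp add: k_def)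
  qed
  \<comment> \<open>At least 2 / c heavy labels would produce 2 k incidences with \<open>Q\<close>.
    Since x \<le> 1 + x (x - 1), the pair count caps the incidences at (1 + \<eta>) k.\<close>
  have "card H < nat \<lceil>2 / c\<rceil>"
  proof (rule ccontr)
    assume "\<not> card H < nat \<lceil>2 / c\<rceil>"
    then obtain G where G: "G \<subseteq> H" "card G = nat \<lceil>2 / c\<rceil>"
      using obtain_subset_with_card_n[of "nat \<lceil>2 / c\<rceil>" H] not_less by metis
    have cG: "2 / c \<le> real (card G)" "real (card G) \<le> 2 / c + 1"
      using G(2) c by (auto simp: of_nat_nat)
    have fG: "finite G" using G fH finite_subset by blast
    have e: "real (card (G \<inter> S v)) = (\<Sum>i\<in>G. of_bool (i \<in> S v))" for v
      using fG by (simp add: of_bool_def sum.If_cases Int_def)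
    have "2 * k \<le> (\<Sum>i\<in>G. c * k)" using cG c k by (simp add: field_simps)
    also have "\<dots> \<le> (\<Sum>i\<in>G. real (card {v\<in>Q. i \<in> S v}))"
      using G by (intro sum_mono) (auto simp: H_def)
    also have "\<dots> = (\<Sum>i\<in>G. \<Sum>v\<in>Q. of_bool (i \<in> S v))"
      using fin by (simp add: of_bool_def sum.If_cases Int_def)
    also have "\<dots> = (\<Sum>v\<in>Q. real (card (G \<inter> S v)))"
      unfolding e by (rule sum.swap)
    also have "\<dots> \<le> (\<Sum>v\<in>Q. 1 + real (card (G \<inter> S v)) * (real (card (G \<inter> S v)) - 1))"
    proof (rule sum_mono)
      fix v
      have "0 \<le> (real (card (G \<inter> S v)) - 1)\<^sup>2" by simp
      then show "real (card (G \<inter> S v)) \<le> 1 + real (card (G \<inter> S v)) * (real (card (G \<inter> S v)) - 1)"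
        by (simp add: power2_eq_square algebra_simps)
    qed
    also have "\<dots> \<le> k + \<eta> * k"
      using pairs[OF G(1) cG(2)] by (simp add: sum.distrib k_def)
    also have "\<dots> < 2 * k" using \<eta> k by simp
    finally show False by simp
  qed
  then have "real (card H) \<le> 2 / c + 1" using c by linarith
  note pairsH = pairs[OF order.refl this]
  \<comment> \<open>Each vertex with two heavy labels adds at least 1 to the pair sum, so at most
    \<eta> k vertices are discarded.\<close>
  define Z where "Z = {v\<in>Q. 2 \<le> card (H \<inter> S v)}"
  have Z: "real (card Z) \<le> \<eta> * k"
  proof -
    have "real (card Z) = (\<Sum>v\<in>Z. 1)" by simp
    also have "\<dots> \<le> (\<Sum>v\<in>Z. real (card (H \<inter> S v)) * (real (card (H \<inter> S v)) - 1))"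
    proof (rule sum_mono)
      fix v assume "v \<in> Z"
      then have "1 * 1 \<le> real (card (H \<inter> S v)) * (real (card (H \<inter> S v)) - 1)"
        by (intro mult_mono) (auto simp: Z_def)
      then show "1 \<le> real (card (H \<inter> S v)) * (real (card (H \<inter> S v)) - 1)" by simp
    qed
    also have "\<dots> \<le> (\<Sum>v\<in>Q. real (card (H \<inter> S v)) * (real (card (H \<inter> S v)) - 1))"
    proof (rule sum_mono2)
      fix v
      show "0 \<le> real (card (H \<inter> S v)) * (real (card (H \<inter> S v)) - 1)"
        by (cases "card (H \<inter> S v)") auto
    qed (use fin in \<open>auto simp: Z_def\<close>)
    finally show ?thesis using pairsH by linarith
  qed
  define Q' where "Q' = Q - Z"
  have fQ': "finite Q'" using fin by (simp add: Q'_def)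
  have "card Q = card Q' + card Z"
    using fin card_Diff_subset[of Z Q] card_mono[of Q Z] by (auto simp: Q'_def Z_def)
  then have cQ': "real (card Q') \<ge> (1 - \<eta>) * k" using Z by (simp add: k_def algebra_simps)
  \<comment> \<open>Vertices without heavy label are kept in singleton classes, so that they can go to either side.\<close>
  define ty where "ty v = (H \<inter> S v, if H \<inter> S v = {} then Some v else None)" for v
  have class_lt: "real (card {v\<in>Q'. ty v = y}) < (1 - 3 * \<eta>) * k" for y
  proof (cases "fst y = {}")
    case True
    have "card {v\<in>Q'. ty v = y} \<le> card (set_option (snd y))"
      using True by (intro card_mono) (auto simp: ty_def split: if_splits)
    also have "\<dots> \<le> 1" by (cases "snd y") auto
    finally have "real (card {v\<in>Q'. ty v = y}) \<le> 1" by simp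
    \<comment> \<open>The numbers 1/8 and 2 are the bounds on \<eta> and \<open>k\<close>; the
      product 5/4 still exceeds the size of a singleton class.\<close>
    also have "1 < (1 - 3 * (1/8)) * (2::real)" by simp
    also have "\<dots> \<le> (1 - 3 * \<eta>) * k" using \<eta> k by (intro mult_mono) auto
    finally show ?thesis .
  next
    case False
    show ?thesis
    proof (cases "{v\<in>Q'. ty v = y} = {}")
      case True
      have "0 < (1 - 3 * \<eta>) * k" using \<eta> k by (intro mult_pos_pos) auto
      then show ?thesis unfolding True by simp
    next
      case ne: False
      then obtain x where "ty x = y" by blast
      then have "fst y \<subseteq> H" by (auto simp: ty_def)
      then obtain i where i: "i \<in> fst y" "i \<in> U" using False by (auto simp: H_def)
      have "card {v\<in>Q'. ty v = y} \<le> card {v\<in>Q. i \<in> S v}"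
        using fin i by (intro card_mono) (auto simp: Q'_def ty_def)
      then show ?thesis using none i by (force simp: k_def not_le)
    qed
  qed
  let ?P = "\<lambda>Y. Y \<subseteq> ty ` Q' \<and> \<eta> * k \<le> real (card {v\<in>Q'. ty v \<in> Y})"
  have full: "?P (ty ` Q')"
  proof -
    have "{v\<in>Q'. ty v \<in> ty ` Q'} = Q'" by auto
    moreover have "\<eta> * k \<le> (1 - \<eta>) * k" using \<eta> k by (intro mult_right_mono) auto
    ultimately show ?thesis using cQ' by simp
  qed
  \<comment> \<open>A smallest union of classes reaching \<eta> k falls below \<eta> k when any one
    class is removed. So \<open>T\<close> has fewer than \<eta> k + (1 - 3 \<eta>) k vertices, which
    leaves at least \<eta> k of the (1 - \<eta>) k vertices of \<open>Q'\<close> for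
    \<open>W\<close>.\<close>
  define Y where "Y = arg_min card ?P"
  have Y: "?P Y" and Ymin: "\<And>Y'. ?P Y' \<Longrightarrow> card Y \<le> card Y'"
    using arg_min_natI[of ?P, OF full, of card] arg_min_nat_le[of ?P _ card] by (auto simp: Y_def)
  have fY: "finite Y" using Y fQ' finite_subset by blast
  define T where "T = {v\<in>Q'. ty v \<in> Y}"
  define W where "W = Q' - T"
  have "0 < \<eta> * k" using \<eta> k by simp
  have "Y \<noteq> {}"
  proof
    assume "Y = {}"
    then show False using Y \<open>0 < \<eta> * k\<close> by simp
  qed
  then obtain y where y: "y \<in> Y" by auto
  have "card (Y - {y}) < card Y" using fY y by (intro psubset_card_mono) auto
  then have "\<not> ?P (Y - {y})" using Ymin[of "Y - {y}"] by linarith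
  then have "real (card {v\<in>Q'. ty v \<in> Y - {y}}) < \<eta> * k" using Y by auto
  moreover have "card T \<le> card {v\<in>Q'. ty v \<in> Y - {y}} + card {v\<in>Q'. ty v = y}"
    using fQ' by (intro order.trans[OF card_mono card_Un_le]) (auto simp: T_def)
  ultimately have cT: "real (card T) < \<eta> * k + (1 - 3 * \<eta>) * k"
    using class_lt[of y] by linarith
  have "card Q' = card T + card W"
    using fQ' card_Diff_subset[of T Q'] card_mono[of Q' T] by (auto simp: W_def T_def)
  then have "\<eta> * k \<le> real (card W)" using cT cQ' by (simp add: algebra_simps)
  then obtain t w where tw: "t \<in> T" "w \<in> W" "\<forall>j\<in>S t \<inter> S w. c * k < real (card {v\<in>Q. j \<in> S v})"
    using split[of T W] Y by (auto simp: T_def W_def Q'_def k_def)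
  have tyne: "ty t \<noteq> ty w" using tw by (auto simp: T_def W_def)
  have Q: "t \<in> Q" "w \<in> Q" "t \<notin> Z" "w \<notin> Z" using tw by (auto simp: T_def W_def Q'_def)
  then obtain j where j: "j \<in> S t" "j \<in> S w" using meet[of t w] tyne by auto
  have jH: "j \<in> H" using j tw Q sub by (auto simp: H_def)
  \<comment> \<open>The common label \<open>j\<close> of \<open>t\<close> and \<open>w\<close> is
    heavy, and outside \<open>Z\<close> no vertex has a second heavy label. Hence \<open>t\<close>
    and \<open>w\<close> have the same type, although \<open>T\<close> is a union of whole
    types.\<close>
  have "H \<inter> S v = {j}" if "v \<in> Q" "v \<notin> Z" "j \<in> S v" for v
  proof -
    have "card (H \<inter> S v) \<le> 1" using that by (auto simp: Z_def)
    moreover have "j \<in> H \<inter> S v" using jH that by auto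
    ultimately show ?thesis using fH card_le_Suc0_iff_eq[of "H \<inter> S v"] by auto
  qed
  then have "ty t = ty w" using Q j by (simp add: ty_def)
  with tyne show False by simp
qed

text \<open>Some label covers a fraction 1 - 3 \<eta> of \<open>Q\<close>. A vertex of
  \<open>Q\<close> without it would be adjacent to at least (1 - 3 \<eta>) (1 - \<eta>) n p \<ge> (1
  - 4 \<eta>) n p vertices of its class, which \<open>nbrs\<close> forbids.\<close>

lemma clique_single_label_if_typical:
  fixes \<eta> \<gamma> D p :: real
  assumes n: "2 \<le> n" and p: "0 < p" and \<eta>: "0 < \<eta>" "\<eta> \<le> 1/8" and \<gamma>: "0 < \<gamma>" and D: "0 \<le> D"
    and small: "(2 / (\<gamma> * \<eta> / ln (real n)) + 1)\<^sup>2 * D \<le> \<eta> * ((1 - \<eta>) * (real n * p))"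
    and lab: "\<And>v. S v \<subseteq> {1..m}"
    and Int: "\<And>i j. i \<in> {1..m} \<Longrightarrow> j \<in> {1..m} \<Longrightarrow> i \<noteq> j \<Longrightarrow> real (card {v\<in>{1..n}. i \<in> S v \<and> j \<in> S v}) \<le> D"
    and nbrs: "\<And>i v. i \<in> {1..m} \<Longrightarrow> v \<in> {1..n} \<Longrightarrow> i \<notin> S v \<Longrightarrow>
       real (card {u\<in>{1..n}. i \<in> S u \<and> S u \<inter> (S v \<inter> {1..m}) \<noteq> {}}) < (1 - 4 * \<eta>) * (real n * p)"
    and joined: "\<And>T W. (T, W) \<in> joined_pairs n \<eta> \<Longrightarrow> \<not> light_joined m S (\<gamma> * real (card T) / ln (real n)) T W"
    and Q: "clique n S Q" "2 \<le> card Q" "(1 - \<eta>) * (real n * p) \<le> real (card Q)"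
  shows "single_label n m S Q"
proof -
  \<comment> \<open>The factor \<eta> turns a threshold relative to \<open>card T\<close> into one
    relative to \<open>card Q\<close>, since each side of a split has at least \<eta> *
    \<open>card Q\<close> vertices.\<close>
  define c where "c = \<gamma> * \<eta> / ln (real n)"
  define k where "k = real (card Q)"
  have QV: "Q \<subseteq> {1..n}" and adj: "\<And>u v. u \<in> Q \<Longrightarrow> v \<in> Q \<Longrightarrow> u \<noteq> v \<Longrightarrow> S u \<inter> S v \<noteq> {}"
    using Q(1) by (auto simp: clique_def adjacent_def)
  have fQ: "finite Q" using QV finite_subset by blast
  have ln: "0 < ln (real n)" using n by simp
  have k: "0 < \<eta> * k" using Q(2) \<eta> by (simp add: k_def)
  have "\<exists>i\<in>{1..m}. (1 - 3 * \<eta>) * real (card Q) \<le> real (card {v\<in>Q. i \<in> S v})"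
  proof (rule exists_dominant_label[where c = c and D = D])
    show "real (card {v\<in>Q. i \<in> S v \<and> j \<in> S v}) \<le> D" if "i \<in> {1..m}" "j \<in> {1..m}" "i \<noteq> j" for i j
    proof -
      have "card {v\<in>Q. i \<in> S v \<and> j \<in> S v} \<le> card {v\<in>{1..n}. i \<in> S v \<and> j \<in> S v}"
        using QV by (intro card_mono) auto
      then show ?thesis using Int[OF that] by linarith
    qed
    show "0 < c" using \<gamma> \<eta> ln by (simp add: c_def)
    have "\<eta> * ((1 - \<eta>) * (real n * p)) \<le> \<eta> * real (card Q)"
      using Q(3) \<eta> by (intro mult_left_mono) auto
    then show "(2 / c + 1)\<^sup>2 * D \<le> \<eta> * real (card Q)"
      using small unfolding c_def by linarith
    fix T W assume T: "T \<subseteq> Q" and W: "W \<subseteq> Q" "T \<inter> W = {}"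
      and cT: "\<eta> * real (card Q) \<le> real (card T)" and cW: "\<eta> * real (card Q) \<le> real (card W)"
    have "card T \<le> card Q" using T fQ by (rule card_mono[rotated])
    then have "\<eta> * real (card T) \<le> \<eta> * real (card Q)" using \<eta> by (intro mult_left_mono) auto
    moreover have "T \<noteq> {}" using cT k by (auto simp: k_def)
    ultimately have "(T, W) \<in> joined_pairs n \<eta>"
      using T W cW QV by (auto simp: joined_pairs_def)
    from joined[OF this] obtain t w where tw: "t \<in> T" "w \<in> W"
      "\<And>j. j \<in> {1..m} \<Longrightarrow> j \<in> S t \<inter> S w \<Longrightarrow> \<gamma> * real (card T) / ln (real n) < real (card {v\<in>T. j \<in> S v})"
      unfolding light_joined_def by (meson not_le)
    have "c * real (card Q) < real (card {v\<in>Q. j \<in> S v})" if j: "j \<in> S t \<inter> S w" for j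
    proof -
      have "c * real (card Q) = \<gamma> / ln (real n) * (\<eta> * real (card Q))" by (simp add: c_def)
      also have "\<dots> \<le> \<gamma> / ln (real n) * real (card T)" using cT \<gamma> ln by (intro mult_left_mono) auto
      also have "\<dots> < real (card {v\<in>T. j \<in> S v})" using tw(3)[of j] j subsetD[OF lab[of t], of j] by simp
      also have "\<dots> \<le> real (card {v\<in>Q. j \<in> S v})"
        using T fQ by (intro of_nat_mono card_mono) auto
      finally show ?thesis .
    qed
    then show "\<exists>t\<in>T. \<exists>w\<in>W. \<forall>j\<in>S t \<inter> S w. c * real (card Q) < real (card {v\<in>Q. j \<in> S v})"
      using tw by blast
  qed (use fQ Q(2) lab adj D \<eta> in auto)
  then obtain i where i: "i \<in> {1..m}" "(1 - 3 * \<eta>) * real (card Q) \<le> real (card {v\<in>Q. i \<in> S v})" by blast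
  have "i \<in> S v" if v: "v \<in> Q" for v
  proof (rule ccontr)
    assume iv: "i \<notin> S v"
    have "{u\<in>Q. i \<in> S u} \<subseteq> {u\<in>{1..n}. i \<in> S u \<and> S u \<inter> (S v \<inter> {1..m}) \<noteq> {}}"
    proof (intro subsetI CollectI conjI)
      fix u assume u: "u \<in> {u\<in>Q. i \<in> S u}"
      show "u \<in> {1..n}" "i \<in> S u" using u QV by auto
      have "u \<noteq> v" using u iv by auto
      then have "S u \<inter> S v \<noteq> {}" using adj[of u v] u v by auto
      then show "S u \<inter> (S v \<inter> {1..m}) \<noteq> {}" using lab[of v] by blast
    qed
    then have "card {u\<in>Q. i \<in> S u} \<le> card {u\<in>{1..n}. i \<in> S u \<and> S u \<inter> (S v \<inter> {1..m}) \<noteq> {}}"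
      by (intro card_mono) auto
    then have "(1 - 3 * \<eta>) * real (card Q) < (1 - 4 * \<eta>) * (real n * p)"
      using i nbrs[OF i(1) _ iv] v QV by fastforce
    moreover have "(1 - 4 * \<eta>) * (real n * p) \<le> (1 - 3 * \<eta>) * (1 - \<eta>) * (real n * p)"
      using p \<eta> by (intro mult_right_mono) (auto simp: algebra_simps)
    moreover have "(1 - 3 * \<eta>) * ((1 - \<eta>) * (real n * p)) \<le> (1 - 3 * \<eta>) * real (card Q)"
      using Q(3) \<eta> by (intro mult_left_mono) auto
    ultimately show False by (simp add: mult.assoc)
  qed
  then have "Q \<subseteq> label_class n S i" using QV by (auto simp: label_class_def)
  then show ?thesis using i by (auto simp: single_label_def)
qed

section \<open>Failure probability in the dense regime\<close>

text \<open>\<eta> is tied to the neighbour bound: 1 - exp (- 2 * B) = 1 - 8 \<eta>. The threshold 1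
  - 4 \<eta> lies strictly above it, which makes the rate \<kappa> positive, and still leaves room
  for the losses 3 \<eta> and \<eta> in \<open>clique_single_label_if_typical\<close>.\<close>

lemma prob_dense_non_single_label_le:
  fixes B C D p z :: real
  assumes n: "2 \<le> n" and p: "0 < p" "p \<le> 1/2" and C: "real m * p\<^sup>2 \<le> C" "0 \<le> C" and B: "B = 2 * C + 1"
    and \<eta>: "\<eta> = exp (- 2 * B) / 8" and \<gamma>: "\<gamma> = ln (1 + ln (1 + exp (- 2 * B)) / B) / (2 / \<eta> + 2)"
    and \<kappa>: "\<kappa> = (1 - 4 * \<eta>) * ln ((1 - 4 * \<eta>) / (1 - 8 * \<eta>)) - ((1 - 4 * \<eta>) / (1 - 8 * \<eta>) - 1) * (1 - 8 * \<eta>)"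
    and D: "0 \<le> D" and z: "1 \<le> z"
    and small: "(2 / (\<gamma> * \<eta> / ln (real n)) + 1)\<^sup>2 * D \<le> \<eta> * ((1 - \<eta>) * (real n * p))"
  shows "measure_pmf.prob (rig_pmf n m p)
      {S. \<exists>Q. clique n S Q \<and> 2 \<le> card Q \<and> (1 - \<eta>) * (real n * p) \<le> real (card Q) \<and> \<not> single_label n m S Q}
     \<le> real n * exp (- 1 / p) + ((real m)\<^sup>2 * exp ((z - 1) * real n * p\<^sup>2 - D * ln z)
       + (real m * real n * exp (- \<kappa> * (real n * p)) + (exp (1 / real n) - 1) * exp (1 / real n)))"
proof -
  have B0: "0 < B" using B C by simp
  have \<eta>0: "0 < \<eta>" "\<eta> < 1/8" using B0 by (auto simp: \<eta>)
  have y: "1 < 1 + ln (1 + exp (- 2 * B)) / B" using B0 by (simp add: add_pos_pos)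
  have \<gamma>0: "0 < \<gamma>" unfolding \<gamma> using y \<eta>0 by (intro divide_pos_pos ln_gt_zero add_pos_pos) auto
  let ?E1 = "\<lambda>S. \<exists>v\<in>{1..n}. B / p \<le> real (card (S v \<inter> {1..m}))"
  let ?E3 = "\<lambda>S. \<exists>(i, j)\<in>{(i, j). i \<in> {1..m} \<and> j \<in> {1..m} \<and> i \<noteq> j}. D \<le> real (card {v\<in>{1..n}. i \<in> S v \<and> j \<in> S v})"
  let ?E4 = "\<lambda>S. \<exists>(i, v)\<in>{1..m} \<times> {1..n}. i \<notin> S v \<and> real (card (S v \<inter> {1..m})) \<le> B / p \<and>
          (1 - 4 * \<eta>) * (real n * p) \<le> real (card {u\<in>{1..n}. i \<in> S u \<and> S u \<inter> (S v \<inter> {1..m}) \<noteq> {}})"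
  let ?E5 = "\<lambda>S. \<exists>(T, W)\<in>joined_pairs n \<eta>.
       (\<forall>t\<in>T. real (card (S t \<inter> {1..m})) \<le> B / p) \<and> light_joined m S (\<gamma> * real (card T) / ln (real n)) T W"
  let ?M = "rig_pmf n m p"
  have e1: "measure_pmf.prob ?M {S. ?E1 S} \<le> real n * exp (- 1 / p)"
    using prob_large_label_set_le[of p m C B n] p C B by simp
  have e3: "measure_pmf.prob ?M {S. ?E3 S} \<le> (real m)\<^sup>2 * exp ((z - 1) * real n * p\<^sup>2 - D * ln z)"
    using p z by (intro prob_label_class_Int_ge_le) auto
  have "measure_pmf.prob ?M {S. ?E4 S} \<le> real m * real n *
      exp ((((1 - 4 * \<eta>) / (1 - 8 * \<eta>) - 1) * (1 - 8 * \<eta>) - (1 - 4 * \<eta>) * ln ((1 - 4 * \<eta>) / (1 - 8 * \<eta>))) * (real n * p))"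
    using p \<eta>0 by (intro prob_many_neighbours_in_class_le) (auto simp: \<eta>)
  also have "\<dots> = real m * real n * exp (- \<kappa> * (real n * p))" by (simp add: \<kappa>)
  finally have e4: "measure_pmf.prob ?M {S. ?E4 S} \<le> real m * real n * exp (- \<kappa> * (real n * p))" .
  have e5: "measure_pmf.prob ?M {S. ?E5 S} \<le> (exp (1 / real n) - 1) * exp (1 / real n)"
    unfolding \<gamma> by (intro prob_ex_light_joined_le n p B0 \<eta>0)
  have "measure_pmf.prob ?M {S. \<exists>Q. clique n S Q \<and> 2 \<le> card Q \<and> (1 - \<eta>) * (real n * p) \<le> real (card Q)
        \<and> \<not> single_label n m S Q}
      \<le> measure_pmf.prob ?M {S. ?E1 S \<or> (?E3 S \<or> (?E4 S \<or> ?E5 S))}"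
  proof (rule prob_mono_on_support, rule ccontr)
    fix S assume S: "S \<in> set_pmf ?M" and nb: "\<not> (?E1 S \<or> (?E3 S \<or> (?E4 S \<or> ?E5 S)))"
    assume "\<exists>Q. clique n S Q \<and> 2 \<le> card Q \<and> (1 - \<eta>) * (real n * p) \<le> real (card Q) \<and> \<not> single_label n m S Q"
    then obtain Q where Q: "clique n S Q" "2 \<le> card Q" "(1 - \<eta>) * (real n * p) \<le> real (card Q)"
      "\<not> single_label n m S Q" by blast
    have n1: "\<not> ?E1 S" and n3: "\<not> ?E3 S" and n4: "\<not> ?E4 S" and n5: "\<not> ?E5 S" using nb by blast+
    have c1: "real (card (S v \<inter> {1..m})) \<le> B / p" if "v \<in> {1..n}" for v using n1 that by force
    have "single_label n m S Q"
    proof (rule clique_single_label_if_typical[OF n p(1) \<eta>0(1) _ \<gamma>0 D small rig_pmf_labels[OF S] _ _ _ Q(1-3)])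
      show "real (card {v\<in>{1..n}. i \<in> S v \<and> j \<in> S v}) \<le> D" if "i \<in> {1..m}" "j \<in> {1..m}" "i \<noteq> j" for i j
        using n3 that by force
      show "real (card {u\<in>{1..n}. i \<in> S u \<and> S u \<inter> (S v \<inter> {1..m}) \<noteq> {}}) < (1 - 4 * \<eta>) * (real n * p)"
        if "i \<in> {1..m}" "v \<in> {1..n}" "i \<notin> S v" for i v
      proof (rule ccontr)
        assume "\<not> ?thesis"
        then have "?E4 S" using that c1[OF that(2)] by (intro bexI[of _ "(i, v)"]) (auto simp: not_less)
        with n4 show False by blast
      qed
      show "\<not> light_joined m S (\<gamma> * real (card T) / ln (real n)) T W" if TW: "(T, W) \<in> joined_pairs n \<eta>" for T W
      proof
        assume lj: "light_joined m S (\<gamma> * real (card T) / ln (real n)) T W"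
        have "\<forall>t\<in>T. real (card (S t \<inter> {1..m})) \<le> B / p" using c1 TW unfolding joined_pairs_def by blast
        then have "?E5 S" using TW lj by (intro bexI[of _ "(T, W)"]) auto
        with n5 show False by blast
      qed
    qed (use \<eta>0 in simp)
    with Q(4) show False by blast
  qed
  also have "\<dots> \<le> measure_pmf.prob ?M {S. ?E1 S} + (measure_pmf.prob ?M {S. ?E3 S}
      + (measure_pmf.prob ?M {S. ?E4 S} + measure_pmf.prob ?M {S. ?E5 S}))"
    by (rule order.trans[OF prob_disj_le add_left_mono[OF order.trans[OF prob_disj_le add_left_mono[OF prob_disj_le]]]])
  finally show ?thesis using e1 e3 e4 e5 by linarith
qed

section \<open>Asymptotics and the two regimes combined\<close>

lemma whpI:
  assumes "eventually (\<lambda>n. measure_pmf.prob (D n) {x. \<not> A n x} \<le> b n) sequentially" "b \<longlonglongrightarrow> 0"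
  shows "whp D A"
proof -
  have eq: "measure_pmf.prob (D n) {x. A n x} = 1 - measure_pmf.prob (D n) {x. \<not> A n x}" for n
    using measure_pmf.prob_compl[of "{x. \<not> A n x}" "D n"] by (simp add: Compl_eq_Diff_UNIV[symmetric] Collect_neg_eq[symmetric])
  have "(\<lambda>n. measure_pmf.prob (D n) {x. \<not> A n x}) \<longlonglongrightarrow> 0"
    by (rule tendsto_sandwich[OF _ assms(1) tendsto_const assms(2)]) auto
  then have "(\<lambda>n. 1 - measure_pmf.prob (D n) {x. \<not> A n x}) \<longlonglongrightarrow> 1 - 0"
    by (intro tendsto_diff tendsto_const)
  then show ?thesis by (simp add: whp_def eq)
qed

text \<open>Hence a maximum clique is at least as large as any label class, in particular that of
  label 1.\<close>

lemma label_class_clique: "clique n S (label_class n S i)"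
  by (auto simp: clique_def label_class_def adjacent_def)

text \<open>A sequence \<epsilon> tending to 0 expresses |Q| ~ n p uniformly over all such cliques,
  and the bound on m n allows either rounding of n^\<alpha>. Requiring two vertices sets aside a
  vertex without labels, which is a clique formed by no label.\<close>

theorem theorem3:
  fixes \<alpha> :: real and m :: "nat \<Rightarrow> nat" and p :: "nat \<Rightarrow> real"
  assumes "0 < \<alpha>" and "\<alpha> < 1"
    and "\<forall>n. \<bar>real (m n) - real n powr \<alpha>\<bar> < 1"
    and "\<forall>n. 0 \<le> p n \<and> p n \<le> 1"
    and "(\<lambda>n. real (m n) * (p n)\<^sup>2) \<in> O(\<lambda>_. 1)"
  shows "(\<forall>\<epsilon> :: nat \<Rightarrow> real. \<epsilon> \<longlonglongrightarrow> 0 \<longrightarrow>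
            whp (\<lambda>n. rig_pmf n (m n) (p n))
                (\<lambda>n S. \<forall>Q. clique n S Q \<and> 2 \<le> card Q \<and>
                            \<bar>real (card Q) - real n * p n\<bar> \<le> \<epsilon> n * (real n * p n)
                          \<longrightarrow> single_label n (m n) S Q))
       \<and> whp (\<lambda>n. rig_pmf n (m n) (p n))
             (\<lambda>n S. \<forall>Q. maximum_clique n S Q \<and> 2 \<le> card Q \<longrightarrow> single_label n (m n) S Q)"
proof -
  have p01: "0 \<le> p n" "p n \<le> 1" for n using assms(4) by auto
  obtain C where C: "0 < C" and "eventually (\<lambda>n. norm (real (m n) * (p n)\<^sup>2) \<le> C * norm (1::real)) sequentially"
    using assms(5) by (elim landau_o.bigE)
  then have evC: "eventually (\<lambda>n. real (m n) * (p n)\<^sup>2 \<le> C) sequentially" by simp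
  define B where "B = 2 * C + 1"
  define \<eta> where "\<eta> = exp (- 2 * B) / 8"
  define \<gamma> where "\<gamma> = ln (1 + ln (1 + exp (- 2 * B)) / B) / (2 / \<eta> + 2)"
  define \<kappa> where "\<kappa> = (1 - 4 * \<eta>) * ln ((1 - 4 * \<eta>) / (1 - 8 * \<eta>)) - ((1 - 4 * \<eta>) / (1 - 8 * \<eta>) - 1) * (1 - 8 * \<eta>)"
  \<comment> \<open>The Chernoff rate for a label class of size at most (1 - \<eta>) n p.\<close>
  define \<nu> where "\<nu> = (1 - \<eta>) * ln (1 - \<eta>) + \<eta>"
  \<comment> \<open>If n p < n^\<delta>, then n m p^2 is at most of order n^(2 \<delta> + \<alpha> -
    1) = n^(-2 \<delta>).\<close>
  define \<delta> where "\<delta> = (1 - \<alpha>) / 4"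
  \<comment> \<open>Intersections of classes are compared with D = n p n^(-\<beta>), using z =
    n^\<beta>. The bound \<alpha> / 8 ensures (z - 1) n p^2 \<le> D eventually, and \<delta> / 2
    ensures D \<ge> n^(\<delta> / 2).\<close>
  define \<beta> where "\<beta> = min (\<alpha> / 8) (\<delta> / 2)"
  \<comment> \<open>From m \<ge> n^\<alpha> / 2 and m p^2 \<le> C follows p \<le> C1 n^(-\<alpha> /
    2).\<close>
  define C1 where "C1 = sqrt (2 * C)"
  have B0: "0 < B" using C by (simp add: B_def)
  have \<eta>: "0 < \<eta>" "\<eta> < 1/8" using B0 by (auto simp: \<eta>_def)
  have y: "1 < 1 + ln (1 + exp (- 2 * B)) / B" using B0 by (simp add: add_pos_pos)
  have \<gamma>: "0 < \<gamma>" unfolding \<gamma>_def using y \<eta> by (intro divide_pos_pos ln_gt_zero add_pos_pos) auto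
  have \<kappa>: "0 < \<kappa>" using chernoff_exponent_neg[of "1 - 8 * \<eta>" "1 - 4 * \<eta>"] \<eta> by (simp add: \<kappa>_def)
  have \<nu>: "0 < \<nu>" using chernoff_exponent_neg[of 1 "1 - \<eta>"] \<eta> by (simp add: \<nu>_def)
  have \<delta>: "0 < \<delta>" and \<alpha>\<delta>: "\<alpha> = 1 - 4 * \<delta>" using assms(2) by (auto simp: \<delta>_def field_simps)
  have \<beta>: "0 < \<beta>" "\<beta> \<le> \<alpha> / 8" "\<beta> \<le> \<delta> / 2" using assms(1) \<delta> by (auto simp: \<beta>_def)
  have C1: "0 < C1" "C1\<^sup>2 = 2 * C" using C by (auto simp: C1_def)
  \<comment> \<open>The terms account in order for a large label set, a large intersection of two
    classes, a vertex with too many neighbours in a class, and a pair joined by light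
    labels.\<close>
  define b1 where "b1 n = real n * exp (- (real n powr (\<alpha> / 2) / C1)) + ((2 * real n)\<^sup>2 * exp (- (real n powr (\<delta> / 2)))
       + (2 * real n * real n * exp (- \<kappa> * real n powr \<delta>) + (exp (1 / real n) - 1) * exp (1 / real n)))" for n :: nat
  define b2 where "b2 n = exp (- \<nu> * real n powr \<delta>)" for n :: nat
  define b3 where "b3 n = (2 * real n powr (- 2 * \<delta>))\<^sup>2 + (2 * real n powr (- 2 * \<delta>)) ^ 3" for n :: nat
  have lim: "(\<lambda>n. b1 n + (b2 n + b3 n)) \<longlonglongrightarrow> 0"
  proof -
    have "b1 \<longlonglongrightarrow> 0" unfolding b1_def
    proof (intro tendsto_add_zero)
      show "(\<lambda>n. real n * exp (- (real n powr (\<alpha> / 2) / C1))) \<longlonglongrightarrow> 0"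
        using assms(1) C1(1) by real_asymp
      show "(\<lambda>n. (2 * real n)\<^sup>2 * exp (- (real n powr (\<delta> / 2)))) \<longlonglongrightarrow> 0"
        using \<delta> by real_asymp
      show "(\<lambda>n. 2 * real n * real n * exp (- \<kappa> * real n powr \<delta>)) \<longlonglongrightarrow> 0"
        using \<delta> \<kappa> by real_asymp
      show "(\<lambda>n. (exp (1 / real n) - 1) * exp (1 / real n)) \<longlonglongrightarrow> 0"
        by real_asymp
    qed
    moreover have "b2 \<longlonglongrightarrow> 0" unfolding b2_def using \<delta> \<nu> by real_asymp
    moreover have "b3 \<longlonglongrightarrow> 0" unfolding b3_def using \<delta> by real_asymp
    ultimately have "(\<lambda>n. b1 n + (b2 n + b3 n)) \<longlonglongrightarrow> 0 + (0 + 0)" by (intro tendsto_add)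
    then show ?thesis by simp
  qed
  have b_nonneg: "0 \<le> b1 n" "0 \<le> b2 n" "0 \<le> b3 n" for n
    by (auto simp: b1_def b2_def b3_def intro!: add_nonneg_nonneg mult_nonneg_nonneg)
  let ?M = "\<lambda>n. rig_pmf n (m n) (p n)"
  let ?F = "\<lambda>n S. \<exists>Q. clique n S Q \<and> 2 \<le> card Q \<and> (1 - \<eta>) * (real n * p n) \<le> real (card Q) \<and> \<not> single_label n (m n) S Q"
  let ?G = "\<lambda>n S. \<exists>Q. clique n S Q \<and> 2 \<le> card Q \<and> \<not> single_label n (m n) S Q"
  let ?L = "\<lambda>n S. real (card (label_class n S 1)) \<le> (1 - \<eta>) * (real n * p n)"

  have ev_n: "eventually (\<lambda>n. 2 \<le> n) sequentially" by (rule eventually_ge_at_top)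
  have ev_m: "eventually (\<lambda>n::nat. 2 \<le> real n powr \<alpha>) sequentially" using assms(1) by real_asymp
  have m_bounds: "real n powr \<alpha> / 2 \<le> real (m n)" "real (m n) \<le> 2 * real n powr \<alpha>" "real (m n) \<le> 2 * real n" "1 \<le> m n"
    if "2 \<le> real n powr \<alpha>" "2 \<le> n" for n
  proof -
    have *: "\<bar>real (m n) - real n powr \<alpha>\<bar> < 1" using assms(3) by blast
    show "real n powr \<alpha> / 2 \<le> real (m n)" and hi: "real (m n) \<le> 2 * real n powr \<alpha>" using * that by linarith+
    have "real n powr \<alpha> \<le> real n powr 1" using that assms(2) by (intro powr_mono) auto
    then show "real (m n) \<le> 2 * real n" using hi by simp
    have "0 < real (m n)" using * that by linarith
    then show "1 \<le> m n" by simp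
  qed

  have sparse: "eventually (\<lambda>n. real n * p n < real n powr \<delta> \<longrightarrow> measure_pmf.prob (?M n) {S. ?G n S} \<le> b3 n) sequentially"
    using ev_n ev_m
  proof eventually_elim
    case (elim n)
    show ?case
    proof
      assume np: "real n * p n < real n powr \<delta>"
      define x where "x = real n * real (m n) * (p n)\<^sup>2"
      have x0: "0 \<le> x" by (simp add: x_def)
      have "x = (real n * p n)\<^sup>2 * real (m n) / real n"
        using elim by (simp add: x_def power2_eq_square)
      also have "\<dots> \<le> (real n powr \<delta>)\<^sup>2 * (2 * real n powr \<alpha>) / real n"
        using np m_bounds(2)[OF elim(2,1)] p01[of n] by (intro divide_right_mono mult_mono power_mono) auto
      also have "\<dots> = 2 * (real n powr (2 * \<delta>) * real n powr \<alpha> * real n powr (- 1))"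
        using elim by (simp add: power2_eq_square powr_minus divide_inverse flip: powr_add)
      also have "\<dots> = 2 * real n powr (- 2 * \<delta>)"
        unfolding powr_add[symmetric] by (simp add: \<alpha>\<delta>)
      finally have x: "x \<le> 2 * real n powr (- 2 * \<delta>)" .
      have "measure_pmf.prob (?M n) {S. ?G n S} \<le> x\<^sup>2 + x ^ 3"
        unfolding x_def by (rule prob_sparse_non_single_label_le[OF p01])
      also have "\<dots> \<le> b3 n" unfolding b3_def using x x0 by (intro add_mono power_mono)
      finally show "measure_pmf.prob (?M n) {S. ?G n S} \<le> b3 n" .
    qed
  qed

  have ev_half: "eventually (\<lambda>n::nat. C1 * real n powr (- \<alpha> / 2) \<le> 1 / 2) sequentially"
    using assms(1) C1 by real_asymp
  have ev_z: "eventually (\<lambda>n::nat. C1 * real n powr (- \<alpha> / 4) \<le> 1) sequentially"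
    using assms(1) C1 by real_asymp
  have ev_ln: "eventually (\<lambda>n::nat. 2 \<le> \<beta> * ln (real n)) sequentially"
    using \<beta>(1) by real_asymp
  \<comment> \<open>The number of heavy labels costs only a factor of order (ln n)^2, which
    n^(-\<beta>) in \<open>D\<close> absorbs.\<close>
  have ev_small: "eventually (\<lambda>n::nat. (2 / (\<gamma> * \<eta> / ln (real n)) + 1)\<^sup>2 * real n powr (- \<beta>) < \<eta> * (1 - \<eta>)) sequentially"
  proof (rule order_tendstoD)
    show "(\<lambda>n::nat. (2 / (\<gamma> * \<eta> / ln (real n)) + 1)\<^sup>2 * real n powr (- \<beta>)) \<longlonglongrightarrow> 0"
      using \<beta>(1) \<gamma> \<eta>(1) by real_asymp
    show "0 < \<eta> * (1 - \<eta>)" using \<eta> by simp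
  qed

  have dense: "eventually (\<lambda>n. real n powr \<delta> \<le> real n * p n \<longrightarrow> measure_pmf.prob (?M n) {S. ?F n S} \<le> b1 n
      \<and> measure_pmf.prob (?M n) {S. ?L n S} \<le> b2 n) sequentially"
    using ev_n ev_m evC ev_half ev_z ev_ln ev_small
  proof eventually_elim
    case (elim n)
    note mb = m_bounds[OF elim(2,1)]
    have n1: "1 \<le> real n" using elim(1) by simp
    show ?case
    proof
      assume np: "real n powr \<delta> \<le> real n * p n"
      have "0 < real n powr \<delta>" using n1 by simp
      then have np0: "0 < real n * p n" using np by linarith
      then have p0: "0 < p n" using n1 by (simp add: zero_less_mult_iff)
      have pC1: "p n \<le> C1 * real n powr (- \<alpha> / 2)"
      proof (rule power2_le_imp_le)
        have "real n powr \<alpha> / 2 * (p n)\<^sup>2 \<le> real (m n) * (p n)\<^sup>2"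
          using mb(1) by (intro mult_right_mono) auto
        then have "real n powr \<alpha> / 2 * (p n)\<^sup>2 \<le> C" using elim(3) by linarith
        then have "(p n)\<^sup>2 \<le> 2 * C * real n powr (- \<alpha>)"
          using n1 by (simp add: powr_minus field_simps)
        also have "\<dots> = (C1 * real n powr (- \<alpha> / 2))\<^sup>2"
        proof -
          have "(real n powr (- \<alpha> / 2))\<^sup>2 = real n powr (- \<alpha>)"
            unfolding power2_eq_square powr_add[symmetric] by simp
          then show ?thesis by (simp only: power_mult_distrib C1)
        qed
        finally show "(p n)\<^sup>2 \<le> (C1 * real n powr (- \<alpha> / 2))\<^sup>2" .
      qed (use C1 in auto)
      then have phalf: "p n \<le> 1/2" using elim(4) by linarith
      define z where "z = real n powr \<beta>"
      define D where "D = real n * p n * real n powr (- \<beta>)"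
      have z: "1 \<le> z" using n1 \<beta> by (simp add: z_def ge_one_powr_ge_zero)
      have D0: "0 \<le> D" using np0 by (simp add: D_def)
      have small: "(2 / (\<gamma> * \<eta> / ln (real n)) + 1)\<^sup>2 * D \<le> \<eta> * ((1 - \<eta>) * (real n * p n))"
        using mult_right_mono[OF less_imp_le[OF elim(7)] less_imp_le[OF np0]] by (simp add: D_def mult_ac)
      have F: "measure_pmf.prob (?M n) {S. ?F n S} \<le> real n * exp (- 1 / p n)
         + ((real (m n))\<^sup>2 * exp ((z - 1) * real n * (p n)\<^sup>2 - D * ln z)
         + (real (m n) * real n * exp (- \<kappa> * (real n * p n)) + (exp (1 / real n) - 1) * exp (1 / real n)))"
        by (rule prob_dense_non_single_label_le[OF elim(1) p0 phalf elim(3) less_imp_le[OF C]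
              B_def \<eta>_def \<gamma>_def \<kappa>_def D0 z small])
      also have "\<dots> \<le> b1 n"
        unfolding b1_def
      proof (intro add_mono mult_mono order.refl)
        have "real n powr (\<alpha> / 2) / C1 \<le> 1 / p n"
        proof -
          have "real n powr (\<alpha> / 2) * p n \<le> real n powr (\<alpha> / 2) * (C1 * real n powr (- \<alpha> / 2))"
            using pC1 by (intro mult_left_mono) auto
          also have "\<dots> = C1" using n1 by (simp add: powr_minus)
          finally show ?thesis using p0 C1 by (simp add: field_simps)
        qed
        then show "exp (- 1 / p n) \<le> exp (- (real n powr (\<alpha> / 2) / C1))" by simp
        show "(real (m n))\<^sup>2 \<le> (2 * real n)\<^sup>2" using mb(3) by (intro power_mono) auto
        have "(z - 1) * real n * (p n)\<^sup>2 \<le> z * real n * (p n)\<^sup>2"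
          by (intro mult_right_mono) auto
        also have "\<dots> = D * (real n powr (2 * \<beta>) * p n)"
        proof -
          have "real n powr (- \<beta>) * real n powr (2 * \<beta>) = z" by (simp add: z_def flip: powr_add)
          then show ?thesis unfolding D_def by (simp add: power2_eq_square mult_ac)
        qed
        also have "\<dots> \<le> D * 1"
        proof (intro mult_left_mono D0)
          have "real n powr (2 * \<beta>) * p n \<le> real n powr (\<alpha> / 4) * (C1 * real n powr (- \<alpha> / 2))"
            using pC1 p0 n1 \<beta> by (intro mult_mono powr_mono) auto
          also have "\<dots> = C1 * real n powr (- \<alpha> / 4)"
          proof -
            have "real n powr (\<alpha> / 4) * real n powr (- \<alpha> / 2) = real n powr (- \<alpha> / 4)"
              by (simp flip: powr_add)
            then show ?thesis by simp
          qed
          finally show "real n powr (2 * \<beta>) * p n \<le> 1" using elim(5) by linarith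
        qed
        finally have "(z - 1) * real n * (p n)\<^sup>2 \<le> D" by simp
        \<comment> \<open>With ln z \<ge> 2 the exponent is at most D - 2 D = - D.\<close>
        moreover have "D * 2 \<le> D * ln z"
          using elim(6) n1 D0 by (intro mult_left_mono) (auto simp: z_def ln_powr)
        moreover have "real n powr (\<delta> / 2) \<le> D"
        proof -
          have "real n powr (\<delta> / 2) \<le> real n powr (\<delta> + - \<beta>)" using \<beta>(3) n1 by (intro powr_mono) auto
          also have "\<dots> \<le> D" unfolding powr_add D_def using np by (intro mult_right_mono) auto
          finally show ?thesis .
        qed
        ultimately show "exp ((z - 1) * real n * (p n)\<^sup>2 - D * ln z) \<le> exp (- (real n powr (\<delta> / 2)))"
          by simp
        have "\<kappa> * real n powr \<delta> \<le> \<kappa> * (real n * p n)" using np \<kappa> by (intro mult_left_mono) auto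
        then show "exp (- \<kappa> * (real n * p n)) \<le> exp (- \<kappa> * real n powr \<delta>)" by simp
      qed (use mb in auto)
      finally have 1: "measure_pmf.prob (?M n) {S. ?F n S} \<le> b1 n" .
      have "measure_pmf.prob (?M n) {S. ?L n S} \<le> exp ((((1 - \<eta>) - 1) - (1 - \<eta>) * ln (1 - \<eta>)) * (real n * p n))"
        using p01[of n] \<eta> mb(4) by (intro prob_label_class_small_le) auto
      also have "\<dots> = exp (- \<nu> * (real n * p n))" by (simp add: \<nu>_def algebra_simps)
      also have "\<dots> \<le> b2 n" unfolding b2_def using np \<nu> by simp
      finally have 2: "measure_pmf.prob (?M n) {S. ?L n S} \<le> b2 n" .
      show "measure_pmf.prob (?M n) {S. ?F n S} \<le> b1 n \<and> measure_pmf.prob (?M n) {S. ?L n S} \<le> b2 n"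
        using 1 2 by blast
    qed
  qed

  \<comment> \<open>The regime is decided separately for each \<open>n\<close>, as n p may cross
    n^\<delta> infinitely often. A failure therefore has to be covered in both regimes, and the sum
    of all three bounds is used.\<close>
  have main: "whp ?M A"
    if A: "eventually (\<lambda>n. \<forall>S. \<not> A n S \<longrightarrow> ?G n S \<and> (?F n S \<or> ?L n S)) sequentially" for A
  proof (rule whpI[OF _ lim])
    show "eventually (\<lambda>n. measure_pmf.prob (?M n) {S. \<not> A n S} \<le> b1 n + (b2 n + b3 n)) sequentially"
      using A sparse dense
    proof eventually_elim
      case (elim n)
      show ?case
      proof (cases "real n * p n < real n powr \<delta>")
        case True
        have "measure_pmf.prob (?M n) {S. \<not> A n S} \<le> measure_pmf.prob (?M n) {S. ?G n S}"
          using elim(1) by (intro measure_pmf.finite_measure_mono) auto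
        then show ?thesis using elim(2) True b_nonneg[of n] by linarith
      next
        case False
        have "measure_pmf.prob (?M n) {S. \<not> A n S} \<le> measure_pmf.prob (?M n) {S. ?F n S \<or> ?L n S}"
          using elim(1) by (intro measure_pmf.finite_measure_mono) auto
        also have "\<dots> \<le> measure_pmf.prob (?M n) {S. ?F n S} + measure_pmf.prob (?M n) {S. ?L n S}"
          by (rule prob_disj_le)
        finally show ?thesis using elim(3) False b_nonneg[of n] by linarith
      qed
    qed
  qed

  show ?thesis
  proof (intro conjI allI impI)
    fix \<epsilon> :: "nat \<Rightarrow> real" assume "\<epsilon> \<longlonglongrightarrow> 0"
    then have ev: "eventually (\<lambda>n. \<epsilon> n < \<eta>) sequentially" using \<eta>(1) by (rule order_tendstoD)
    show "whp ?M (\<lambda>n S. \<forall>Q. clique n S Q \<and> 2 \<le> card Q \<and>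
            \<bar>real (card Q) - real n * p n\<bar> \<le> \<epsilon> n * (real n * p n) \<longrightarrow> single_label n (m n) S Q)"
      using ev
    proof (intro main, eventually_elim)
      case (elim n)
      have "(1 - \<eta>) * (real n * p n) \<le> real (card Q)"
        if "\<bar>real (card Q) - real n * p n\<bar> \<le> \<epsilon> n * (real n * p n)" for Q :: "nat set"
      proof -
        have "\<epsilon> n * (real n * p n) \<le> \<eta> * (real n * p n)" using elim p01[of n] by (intro mult_right_mono) auto
        then show ?thesis using that by (simp add: algebra_simps)
      qed
      then show ?case by blast
    qed
  next
    show "whp ?M (\<lambda>n S. \<forall>Q. maximum_clique n S Q \<and> 2 \<le> card Q \<longrightarrow> single_label n (m n) S Q)"
    proof (intro main always_eventually allI impI)
      fix n S
      assume "\<not> (\<forall>Q. maximum_clique n S Q \<and> 2 \<le> card Q \<longrightarrow> single_label n (m n) S Q)"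
      then obtain Q where Q: "maximum_clique n S Q" "2 \<le> card Q" "\<not> single_label n (m n) S Q" by blast
      then have cl: "clique n S Q" and "card (label_class n S 1) \<le> card Q"
        using label_class_clique[of n S 1] by (auto simp: maximum_clique_def)
      \<comment> \<open>Either the class of label 1 is exceptionally small, or the maximum clique is
        large enough for the dense estimate.\<close>
      then have "(1 - \<eta>) * (real n * p n) \<le> real (card Q) \<or> ?L n S" by linarith
      then show "?G n S \<and> (?F n S \<or> ?L n S)" using cl Q by blast
    qed
  qed
qed

end
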